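(* Let $\mathbf v\in\mathbb R_{>0}^m$ and let $(\mathcal V,\mathcal W)\in\mathcal{DRS}_{\mathbf v}$ be a local $d_P$-minimizer of the joint potential on $\mathcal{DRS}_{\mathbf v}$, with $\mathcal V=(V_i)_{i=1}^m$. Then: (1) $S_{\mathcal V}$ belongs to the commutant $C_{\mathcal V}=\{A\in M_d(\mathbb C):AV_i^*V_i=V_i^*V_iA\ \forall i\}$; (2) if $\sigma(S_{\mathcal V})=\{\sigma_1,\dots,\sigma_r\}$, then each spectral projection $P_{\sigma_j}$ of $S_{\mathcal V}$ (the orthogonal projection onto $\ker(S_{\mathcal V}-\sigma_jI_d)$) belongs to $C_{\mathcal V}$, for $j=1,\dots,r$.
   Context: Fix integers $m,d\ge1$ and $\mathbf k=(k_1,\dots,k_m)\in\mathbb N^m$ with each $k_i\le d$. A system is an $m$-tuple $\mathcal V=(V_i)_{i=1}^m$ with $V_i\in L(\mathbb C^d,\mathbb C^{k_i})$; its RS operator is $S_{\mathcal V}=\sum_iV_i^*V_i$, and $\mathcal V$ is a reconstruction system (RS) if $S_{\mathcal V}$ is invertible; $\mathcal{RS}(m,\mathbf k,d)$ is the set of RS's. Given weights $\mathbf v\in\mathbb R_{>0}^m$, $\mathcal P_{\mathbf v}(m,\mathbf k,d)$ is the set of RS's with $V_iV_i^*=v_i^2I_{k_i}$ for all $i$. $\mathcal W\in\mathcal{RS}$ is a dual of $\mathcal V$ if $\sum_iW_i^*V_i=I_d$, and $\mathcal D(\mathcal V)$ is the set of duals. $\mathcal{DRS}_{\mathbf v}=\{(\mathcal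 V,\mathcal W)\in\mathcal P_{\mathbf v}\times\mathcal{RS}(m,\mathbf k,d):\mathcal W\in\mathcal D(\mathcal V)\}$, joint potential $\mathrm{FP}(\mathcal V,\mathcal W)=\operatorname{tr}S_{\mathcal V}^2+\operatorname{tr}S_{\mathcal W}^2$. The metric $d_P(\mathcal V,\mathcal W)=(\sum_i\|V_i-W_i\|_2^2)^{1/2}$ uses the Frobenius norm. A pair in $\mathcal{DRS}_{\mathbf v}$ is a local $d_P$-minimizer of FP if there is $\varepsilon>0$ with $\mathrm{FP}(\mathcal V',\mathcal W')\ge\mathrm{FP}(\mathcal V,\mathcal W)$ for all $(\mathcal V',\mathcal W')\in\mathcal{DRS}_{\mathbf v}$ with $d_P(\mathcal V,\mathcal V')+d_P(\mathcal W,\mathcal W')<\varepsilon$. *)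

theory Defs
  imports "Jordan_Normal_Form.Schur_Decomposition"
begin

(* A system is a function V :: nat => complex mat, with V i \<in> carrier_mat (k i) d for i < m
   (V_i : C^d -> C^{k_i}). Only indices i < m are relevant. *)

definition is_system :: "nat \<Rightarrow> (nat \<Rightarrow> nat) \<Rightarrow> nat \<Rightarrow> (nat \<Rightarrow> complex mat) \<Rightarrow> bool" where
  "is_system m k d V \<longleftrightarrow> (\<forall>i<m. V i \<in> carrier_mat (k i) d)"

definition rs_op :: "nat \<Rightarrow> nat \<Rightarrow> (nat \<Rightarrow> complex mat) \<Rightarrow> complex mat" where
  "rs_op m d V = foldr (\<lambda>i acc. mat_adjoint (V i) * V i + acc) [0..<m] (0\<^sub>m d d)"

definition RS :: "nat \<Rightarrow> (nat \<Rightarrow> nat) \<Rightarrow> nat \<Rightarrow> (nat \<Rightarrow> complex mat) set" where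
  "RS m k d = {V. is_system m k d V \<and> invertible_mat (rs_op m d V)}"

definition Pv :: "(nat \<Rightarrow> real) \<Rightarrow> nat \<Rightarrow> (nat \<Rightarrow> nat) \<Rightarrow> nat \<Rightarrow> (nat \<Rightarrow> complex mat) set" where
  "Pv v m k d = {V \<in> RS m k d. \<forall>i<m. V i * mat_adjoint (V i) = complex_of_real ((v i)\<^sup>2) \<cdot>\<^sub>m 1\<^sub>m (k i)}"

definition cross_op :: "nat \<Rightarrow> nat \<Rightarrow> (nat \<Rightarrow> complex mat) \<Rightarrow> (nat \<Rightarrow> complex mat) \<Rightarrow> complex mat" where
  "cross_op m d W V = foldr (\<lambda>i acc. mat_adjoint (W i) * V i + acc) [0..<m] (0\<^sub>m d d)"

definition duals :: "nat \<Rightarrow> (nat \<Rightarrow> nat) \<Rightarrow> nat \<Rightarrow> (nat \<Rightarrow> complex mat) \<Rightarrow> (nat \<Rightarrow> complex mat) set" where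
  "duals m k d V = {W \<in> RS m k d. cross_op m d W V = 1\<^sub>m d}"

definition DRS :: "(nat \<Rightarrow> real) \<Rightarrow> nat \<Rightarrow> (nat \<Rightarrow> nat) \<Rightarrow> nat \<Rightarrow> ((nat \<Rightarrow> complex mat) \<times> (nat \<Rightarrow> complex mat)) set" where
  "DRS v m k d = {(V, W). V \<in> Pv v m k d \<and> W \<in> RS m k d \<and> W \<in> duals m k d V}"

definition mtrace :: "complex mat \<Rightarrow> complex" where
  "mtrace A = (\<Sum>i<dim_row A. A $$ (i, i))"

(* joint frame potential tr S_V^2 + tr S_W^2 (a real number, since S_V, S_W are Hermitian;
   we take the real part) *)
definition FP :: "nat \<Rightarrow> nat \<Rightarrow> (nat \<Rightarrow> complex mat) \<Rightarrow> (nat \<Rightarrow> complex mat) \<Rightarrow> real" where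
  "FP m d V W = Re (mtrace (rs_op m d V * rs_op m d V) + mtrace (rs_op m d W * rs_op m d W))"

definition frob_sq :: "complex mat \<Rightarrow> real" where
  "frob_sq A = (\<Sum>i<dim_row A. \<Sum>j<dim_col A. (cmod (A $$ (i, j)))\<^sup>2)"

definition dP :: "nat \<Rightarrow> (nat \<Rightarrow> complex mat) \<Rightarrow> (nat \<Rightarrow> complex mat) \<Rightarrow> real" where
  "dP m V W = sqrt (\<Sum>i<m. frob_sq (V i - W i))"

definition local_dP_minimizer ::
  "(nat \<Rightarrow> real) \<Rightarrow> nat \<Rightarrow> (nat \<Rightarrow> nat) \<Rightarrow> nat \<Rightarrow> (nat \<Rightarrow> complex mat) \<Rightarrow> (nat \<Rightarrow> complex mat) \<Rightarrow> bool" where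
  "local_dP_minimizer v m k d V W \<longleftrightarrow> (V, W) \<in> DRS v m k d \<and>
     (\<exists>\<epsilon>>0. \<forall>V' W'. (V', W') \<in> DRS v m k d \<longrightarrow> dP m V V' + dP m W W' < \<epsilon> \<longrightarrow>
        FP m d V' W' \<ge> FP m d V W)"

definition commutant :: "nat \<Rightarrow> nat \<Rightarrow> (nat \<Rightarrow> complex mat) \<Rightarrow> complex mat set" where
  "commutant m d V = {A \<in> carrier_mat d d.
     \<forall>i<m. A * (mat_adjoint (V i) * V i) = (mat_adjoint (V i) * V i) * A}"

definition is_orth_proj_onto :: "nat \<Rightarrow> complex mat \<Rightarrow> complex vec set \<Rightarrow> bool" where
  "is_orth_proj_onto d P K \<longleftrightarrow> P \<in> carrier_mat d d \<and> P * P = P \<and> mat_adjoint P = P \<and>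
     {P *\<^sub>v x | x. x \<in> carrier_vec d} = K"

definition spectral_proj :: "nat \<Rightarrow> complex mat \<Rightarrow> complex \<Rightarrow> complex mat \<Rightarrow> bool" where
  "spectral_proj d S \<sigma> P \<longleftrightarrow>
     is_orth_proj_onto d P {x \<in> carrier_vec d. (S - \<sigma> \<cdot>\<^sub>m 1\<^sub>m d) *\<^sub>v x = 0\<^sub>v d}"

end

theory Submission
  imports Defs
begin

text \<open>Write \<open>S = S\<^sub>V\<close> and \<open>R = S\<inverse>\<close>. Varying only the dual shows that \<open>W\<close> is the canonical dual
  \<open>V\<^sub>iR\<close>. Next rotate a single operator, \<open>V\<^sub>i \<mapsto> V\<^sub>iU(t)\<close> with \<open>U(t)\<close> unitary, \<open>U(0) = 1\<close> and
  \<open>U'(0) = X\<close> skew-Hermitian, and follow with the canonical dual. With \<open>G = V\<^sub>i\<^sup>*V\<^sub>i\<close>, vanishing of the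
  first variation of \<open>tr S\<^sup>2 + tr S\<^sup>-\<^sup>2\<close> reads \<open>Re tr([S - R\<^sup>3, G] X) = 0\<close>. For \<open>X = K\<^sup>*\<close>, \<open>K = [S, G]\<close>, and
  since \<open>[R\<^sup>3, G] = -(R\<^sup>3KR + R\<^sup>2KR\<^sup>2 + RKR\<^sup>3)\<close>, this is a sum of nonnegative terms, one of which is
  \<open>tr K\<^sup>*K\<close>; hence \<open>K = 0\<close>. Finally, \<open>G\<close> preserves each eigenspace of \<open>S\<close>, so \<open>GP = PGP\<close>, and taking
  adjoints gives \<open>PG = GP\<close>.\<close>

subsection \<open>Adjoints, traces and the Frobenius norm\<close>

lemma mat_adjoint_dim [simp]:
  "dim_row (mat_adjoint A) = dim_col A" "dim_col (mat_adjoint A) = dim_row A"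
  unfolding mat_adjoint_def by (simp_all add: mat_of_rows_def)

lemma mat_adjoint_carrier [simp]:
  "A \<in> carrier_mat n p \<Longrightarrow> mat_adjoint A \<in> carrier_mat p n"
  by (metis carrier_matD carrier_matI mat_adjoint_dim)

lemma mat_adjoint_index [simp]:
  fixes A :: "complex mat"
  shows "i < dim_col A \<Longrightarrow> j < dim_row A \<Longrightarrow> mat_adjoint A $$ (i, j) = cnj (A $$ (j, i))"
  unfolding mat_adjoint_def by (simp add: mat_of_rows_index)

lemma mult_mat_index:
  assumes "A \<in> carrier_mat n p" "B \<in> carrier_mat p q" "i < n" "j < q"
  shows "(A * B) $$ (i, j) = (\<Sum>l<p. A $$ (i, l) * B $$ (l, j))"
  using assms by (auto simp: scalar_prod_def lessThan_atLeast0)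

lemma mat_adjoint_mult:
  fixes A B :: "complex mat"
  assumes "A \<in> carrier_mat n p" "B \<in> carrier_mat p q"
  shows "mat_adjoint (A * B) = mat_adjoint B * mat_adjoint A"
proof (rule eq_matI)
  fix i j assume "i < dim_row (mat_adjoint B * mat_adjoint A)" "j < dim_col (mat_adjoint B * mat_adjoint A)"
  then have i: "i < q" and j: "j < n" using assms by auto
  have "mat_adjoint (A * B) $$ (i, j) = cnj ((A * B) $$ (j, i))"
    using assms i j by (intro mat_adjoint_index) auto
  also have "\<dots> = (\<Sum>l<p. cnj (A $$ (j, l)) * cnj (B $$ (l, i)))"
    unfolding mult_mat_index[OF assms j i] by simp
  also have "\<dots> = (\<Sum>l<p. mat_adjoint B $$ (i, l) * mat_adjoint A $$ (l, j))"
    using assms i j by (intro sum.cong) auto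
  also have "\<dots> = (mat_adjoint B * mat_adjoint A) $$ (i, j)"
    using assms i j by (intro mult_mat_index[symmetric]) auto
  finally show "mat_adjoint (A * B) $$ (i, j) = (mat_adjoint B * mat_adjoint A) $$ (i, j)" .
qed (use assms in auto)

lemma mat_adjoint_mat_adjoint [simp]: "mat_adjoint (mat_adjoint A) = (A :: complex mat)"
  by (rule eq_matI) auto

lemma mat_adjoint_one [simp]: "mat_adjoint (1\<^sub>m n) = (1\<^sub>m n :: complex mat)"
  by (rule eq_matI) auto

lemma mat_adjoint_zero [simp]: "mat_adjoint (0\<^sub>m n p) = (0\<^sub>m p n :: complex mat)"
  by (rule eq_matI) auto

lemma mat_adjoint_add:
  fixes A B :: "complex mat"
  assumes "A \<in> carrier_mat n p" "B \<in> carrier_mat n p"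
  shows "mat_adjoint (A + B) = mat_adjoint A + mat_adjoint B"
  by (rule eq_matI) (use assms in auto)

lemma mat_adjoint_minus:
  fixes A B :: "complex mat"
  assumes "A \<in> carrier_mat n p" "B \<in> carrier_mat n p"
  shows "mat_adjoint (A - B) = mat_adjoint A - mat_adjoint B"
  by (rule eq_matI) (use assms in auto)

lemma mat_adjoint_smult:
  "mat_adjoint (c \<cdot>\<^sub>m A) = cnj c \<cdot>\<^sub>m mat_adjoint (A :: complex mat)"
  by (rule eq_matI) auto

lemma mtrace_add:
  assumes "A \<in> carrier_mat n n" "B \<in> carrier_mat n n"
  shows "mtrace (A + B) = mtrace A + mtrace B"
  using assms by (auto simp: mtrace_def sum.distrib)

lemma mtrace_minus:
  assumes "A \<in> carrier_mat n n" "B \<in> carrier_mat n n"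
  shows "mtrace (A - B) = mtrace A - mtrace B"
  using assms by (auto simp: mtrace_def sum_subtractf)

lemma mtrace_smult:
  assumes "A \<in> carrier_mat n n"
  shows "mtrace (c \<cdot>\<^sub>m A) = c * mtrace A"
  using assms by (auto simp: mtrace_def sum_distrib_left)

lemma mtrace_mult:
  assumes "A \<in> carrier_mat n p" "B \<in> carrier_mat p n"
  shows "mtrace (A * B) = (\<Sum>i<n. \<Sum>l<p. A $$ (i, l) * B $$ (l, i))"
  using assms by (auto simp: mtrace_def mult_mat_index[OF assms] simp del: index_mult_mat(1))

lemma mtrace_comm:
  assumes "A \<in> carrier_mat n p" "B \<in> carrier_mat p n"
  shows "mtrace (A * B) = mtrace (B * A)"
  unfolding mtrace_mult[OF assms] mtrace_mult[OF assms(2,1)]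
  by (subst sum.swap) (simp add: mult.commute)

lemma frob_sq_nonneg: "0 \<le> frob_sq A"
  unfolding frob_sq_def by (intro sum_nonneg) auto

lemma frob_sq_eq_0:
  assumes "A \<in> carrier_mat n p" "frob_sq A = 0"
  shows "A = 0\<^sub>m n p"
proof (rule eq_matI)
  fix i j assume ij: "i < dim_row (0\<^sub>m n p :: complex mat)" "j < dim_col (0\<^sub>m n p :: complex mat)"
  have *: "(\<Sum>i<n. \<Sum>j<p. (cmod (A $$ (i, j)))\<^sup>2) = 0"
    using assms by (auto simp: frob_sq_def)
  then have "(\<Sum>j<p. (cmod (A $$ (i, j)))\<^sup>2) = 0"
    using ij by (subst (asm) sum_nonneg_eq_0_iff) (auto intro: sum_nonneg)
  then show "A $$ (i, j) = 0\<^sub>m n p $$ (i, j)"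
    using ij by (subst (asm) sum_nonneg_eq_0_iff) auto
qed (use assms in auto)

lemma mtrace_adjoint_mult_self:
  "mtrace (mat_adjoint A * A) = complex_of_real (frob_sq A)"
proof -
  have "mtrace (mat_adjoint A * A)
      = (\<Sum>j<dim_col A. \<Sum>i<dim_row A. cnj (A $$ (i, j)) * A $$ (i, j))"
    by (subst mtrace_mult[of _ "dim_col A" "dim_row A"]) auto
  also have "\<dots> = (\<Sum>j<dim_col A. \<Sum>i<dim_row A. complex_of_real ((cmod (A $$ (i, j)))\<^sup>2))"
    by (intro sum.cong refl) (metis complex_norm_square mult.commute)
  also have "\<dots> = complex_of_real (frob_sq A)"
    unfolding frob_sq_def by (subst sum.swap) simp
  finally show ?thesis .
qed

subsection \<open>Cross operators of systems\<close>

lemma is_system_Suc: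
  "is_system (Suc m) k d V \<longleftrightarrow> is_system m k d V \<and> V m \<in> carrier_mat (k m) d"
  unfolding is_system_def by (auto simp: less_Suc_eq)

lemma foldr_add_carrier:
  assumes "\<And>i. i \<in> set xs \<Longrightarrow> f i \<in> carrier_mat n p" "Z \<in> carrier_mat n p"
  shows "foldr (\<lambda>i acc. f i + acc) xs Z \<in> carrier_mat n p"
  using assms by (induction xs) auto

text \<open>\<open>upt\<close> grows at its right end, so the summand with the largest index is the
  first to meet the accumulator of the fold. Splitting off an arbitrary accumulator \<open>Z\<close>
  turns this into adding a last summand, which gives \<open>cross_op_Suc\<close>.\<close>

lemma foldr_add_mat:
  fixes Z :: "complex mat"
  assumes "\<And>i. i \<in> set xs \<Longrightarrow> f i \<in> carrier_mat n p" "Z \<in> carrier_mat n p"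
  shows "foldr (\<lambda>i acc. f i + acc) xs Z = foldr (\<lambda>i acc. f i + acc) xs (0\<^sub>m n p) + Z"
  using assms(1)
proof (induction xs)
  case Nil
  then show ?case using assms(2) by simp
next
  case (Cons a xs)
  let ?F = "foldr (\<lambda>i acc. f i + acc) xs"
  have "?F (0\<^sub>m n p) \<in> carrier_mat n p"
    using Cons.prems by (intro foldr_add_carrier) auto
  then have "f a + (?F (0\<^sub>m n p) + Z) = (f a + ?F (0\<^sub>m n p)) + Z"
    using Cons.prems assms(2) by (simp add: assoc_add_mat[of _ n p])
  then show ?case using Cons by simp
qed

text \<open>The frame operator is the diagonal of a map that is sesquilinear in two systems;
  computations are done for \<open>cross_op\<close> and transferred by this identity.\<close>

lemma rs_op_eq_cross_op: "rs_op m d V = cross_op m d V V"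
  unfolding rs_op_def cross_op_def ..

lemma cross_op_0 [simp]: "cross_op 0 d W V = 0\<^sub>m d d"
  unfolding cross_op_def by simp

lemma adjoint_mult_carrier:
  "A \<in> carrier_mat n d \<Longrightarrow> B \<in> carrier_mat n e \<Longrightarrow> mat_adjoint A * B \<in> carrier_mat d e"
  by (metis mat_adjoint_carrier mult_carrier_mat)

lemma cross_op_carrier:
  assumes "is_system m k d W" "is_system m k d V"
  shows "cross_op m d W V \<in> carrier_mat d d"
  unfolding cross_op_def
  by (rule foldr_add_carrier)
    (use assms in \<open>auto simp: is_system_def intro!: adjoint_mult_carrier\<close>)

lemma cross_op_Suc:
  assumes "is_system (Suc m) k d W" "is_system (Suc m) k d V"
  shows "cross_op (Suc m) d W V = cross_op m d W V + mat_adjoint (W m) * V m"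
proof -
  have *: "mat_adjoint (W i) * V i \<in> carrier_mat d d" if "i < Suc m" for i
    using assms that by (auto simp: is_system_def intro!: adjoint_mult_carrier)
  show ?thesis
    unfolding cross_op_def
    using *[of m] foldr_add_mat[of "[0..<m]" "\<lambda>i. mat_adjoint (W i) * V i" d d
          "mat_adjoint (W m) * V m"] *
    by simp
qed

lemma cross_op_cong:
  assumes "\<And>i. i < m \<Longrightarrow> W i = W' i" "\<And>i. i < m \<Longrightarrow> V i = V' i"
  shows "cross_op m d W V = cross_op m d W' V'"
  unfolding cross_op_def by (rule foldr_cong) (use assms in auto)

lemma mat_adjoint_cross_op:
  assumes "is_system m k d W" "is_system m k d V"
  shows "mat_adjoint (cross_op m d W V) = cross_op m d V W"
  using assms
proof (induction m)
  case (Suc m)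
  then have s: "is_system m k d W" "is_system m k d V" "W m \<in> carrier_mat (k m) d"
    "V m \<in> carrier_mat (k m) d" by (auto simp: is_system_Suc)
  have "mat_adjoint (cross_op (Suc m) d W V)
      = mat_adjoint (cross_op m d W V) + mat_adjoint (mat_adjoint (W m) * V m)"
    unfolding cross_op_Suc[OF Suc.prems]
    by (rule mat_adjoint_add[OF cross_op_carrier[OF s(1,2)] adjoint_mult_carrier[OF s(3,4)]])
  also have "mat_adjoint (mat_adjoint (W m) * V m) = mat_adjoint (V m) * W m"
    by (subst mat_adjoint_mult[of _ d "k m" _ d]) (use s in auto)
  finally show ?case
    using Suc.IH s by (simp add: cross_op_Suc[OF Suc.prems(2,1)])
qed simp

lemma is_system_mult:
  "is_system m k d V \<Longrightarrow> T \<in> carrier_mat d e \<Longrightarrow> is_system m k e (\<lambda>i. V i * T)"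
  unfolding is_system_def by (auto intro: mult_carrier_mat)

lemma is_system_add:
  "is_system m k d V \<Longrightarrow> is_system m k d W \<Longrightarrow> is_system m k d (\<lambda>i. V i + W i)"
  unfolding is_system_def by auto

lemma is_system_minus:
  "is_system m k d V \<Longrightarrow> is_system m k d W \<Longrightarrow> is_system m k d (\<lambda>i. V i - W i)"
  unfolding is_system_def by (auto intro: minus_carrier_mat)

lemma is_system_smult:
  "is_system m k d V \<Longrightarrow> is_system m k d (\<lambda>i. c \<cdot>\<^sub>m V i)"
  unfolding is_system_def by auto

lemma cross_op_mult_right:
  assumes "is_system m k d W" "is_system m k d V" "T \<in> carrier_mat d d"
  shows "cross_op m d W (\<lambda>i. V i * T) = cross_op m d W V * T"
  using assms
proof (induction m)
  case (Suc m)
  then have s: "is_system m k d W" "is_system m k d V" "W m \<in> carrier_mat (k m) d"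
    "V m \<in> carrier_mat (k m) d" by (auto simp: is_system_Suc)
  have "mat_adjoint (W m) * (V m * T) = mat_adjoint (W m) * V m * T"
    by (rule assoc_mult_mat[symmetric, of _ d "k m" _ d _ d]) (use s Suc in auto)
  moreover have "cross_op (Suc m) d W V * T = cross_op m d W V * T + mat_adjoint (W m) * V m * T"
    unfolding cross_op_Suc[OF Suc.prems(1,2)]
    by (rule add_mult_distrib_mat[OF cross_op_carrier[OF s(1,2)] adjoint_mult_carrier[OF s(3,4)]])
      (rule Suc)
  ultimately show ?case
    using Suc.IH[OF s(1,2) Suc.prems(3)]
    by (simp add: cross_op_Suc[OF Suc.prems(1) is_system_mult[OF Suc.prems(2,3)]])
qed simp

text \<open>Adjunction swaps the two systems, so \<open>cross_op_mult_right\<close> gives this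
  without a second induction.\<close>

lemma cross_op_mult_left:
  assumes "is_system m k d W" "is_system m k d V" "T \<in> carrier_mat d d"
  shows "cross_op m d (\<lambda>i. W i * T) V = mat_adjoint T * cross_op m d W V"
  using mat_adjoint_cross_op[OF assms(2) is_system_mult[OF assms(1,3)]]
    mat_adjoint_mult[OF cross_op_carrier[OF assms(2,1)] assms(3)]
    mat_adjoint_cross_op[OF assms(2,1)] cross_op_mult_right[OF assms(2,1,3)]
  by simp

lemma cross_op_conj:
  assumes "is_system m k d V" "T \<in> carrier_mat d d"
  shows "cross_op m d (\<lambda>i. V i * T) (\<lambda>i. V i * T) = mat_adjoint T * cross_op m d V V * T"
  using assms
  by (subst cross_op_mult_left[OF assms(1) is_system_mult[OF assms] assms(2)],
      subst cross_op_mult_right[OF assms(1,1,2)],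
      subst assoc_mult_mat[of _ d d _ d _ d]) (auto intro: cross_op_carrier)

lemma cross_op_add_right:
  assumes "is_system m k d W" "is_system m k d V" "is_system m k d V'"
  shows "cross_op m d W (\<lambda>i. V i + V' i) = cross_op m d W V + cross_op m d W V'"
  using assms
proof (induction m)
  case (Suc m)
  then have s: "is_system m k d W" "is_system m k d V" "is_system m k d V'"
    "W m \<in> carrier_mat (k m) d" "V m \<in> carrier_mat (k m) d" "V' m \<in> carrier_mat (k m) d"
    by (auto simp: is_system_Suc)
  note c = cross_op_carrier[OF s(1,2)] cross_op_carrier[OF s(1,3)]
    adjoint_mult_carrier[OF s(4,5)] adjoint_mult_carrier[OF s(4,6)]
  have "mat_adjoint (W m) * (V m + V' m) = mat_adjoint (W m) * V m + mat_adjoint (W m) * V' m"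
    by (rule mult_add_distrib_mat[of _ d "k m" _ d]) (use s in auto)
  then have "cross_op (Suc m) d W (\<lambda>i. V i + V' i)
    = (cross_op m d W V + cross_op m d W V') + (mat_adjoint (W m) * V m + mat_adjoint (W m) * V' m)"
    using Suc.IH[OF s(1-3)]
    by (simp add: cross_op_Suc[OF Suc.prems(1) is_system_add[OF Suc.prems(2,3)]])
  also have "\<dots> = (cross_op m d W V + mat_adjoint (W m) * V m)
      + (cross_op m d W V' + mat_adjoint (W m) * V' m)"
    by (rule eq_matI) (use c in \<open>auto simp del: index_mult_mat(1)\<close>)
  finally show ?case
    by (simp add: cross_op_Suc[OF Suc.prems(1,2)] cross_op_Suc[OF Suc.prems(1,3)])
qed simp

lemma cross_op_smult_right:
  assumes "is_system m k d W" "is_system m k d V"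
  shows "cross_op m d W (\<lambda>i. c \<cdot>\<^sub>m V i) = c \<cdot>\<^sub>m cross_op m d W V"
proof -
  \<comment> \<open>A scalar factor is right multiplication by a scalar matrix.\<close>
  have "cross_op m d W (\<lambda>i. c \<cdot>\<^sub>m V i) = cross_op m d W (\<lambda>i. V i * (c \<cdot>\<^sub>m 1\<^sub>m d))"
    using assms(2)
    by (intro cross_op_cong) (auto simp: is_system_def mult_smult_distrib[of _ _ d _ d])
  also have "\<dots> = c \<cdot>\<^sub>m cross_op m d W V"
    using cross_op_carrier[OF assms]
    by (subst cross_op_mult_right[OF assms]) (auto simp: mult_smult_distrib[of _ d d _ d])
  finally show ?thesis .
qed

lemma cross_op_minus_right:
  assumes "is_system m k d W" "is_system m k d V" "is_system m k d V'"
  shows "cross_op m d W (\<lambda>i. V i - V' i) = cross_op m d W V - cross_op m d W V'"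
proof -
  have "cross_op m d W (\<lambda>i. V i - V' i) = cross_op m d W (\<lambda>i. V i + (-1) \<cdot>\<^sub>m V' i)"
    using assms(2,3) by (intro cross_op_cong refl eq_matI) (auto simp: is_system_def)
  also have "\<dots> = cross_op m d W V + (-1) \<cdot>\<^sub>m cross_op m d W V'"
    using cross_op_add_right[OF assms(1,2) is_system_smult[OF assms(3)]]
      cross_op_smult_right[OF assms(1,3)] by simp
  also have "\<dots> = cross_op m d W V - cross_op m d W V'"
    by (rule eq_matI) (use cross_op_carrier[OF assms(1,2)] cross_op_carrier[OF assms(1,3)] in auto)
  finally show ?thesis .
qed

text \<open>Replacing one member changes one summand. The derivative of the frame operator under a
  rotation of \<open>V i\<close> thereby reduces to that of the single term
  \<open>mat_adjoint X * X\<close>.\<close>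

lemma cross_op_update:
  assumes "is_system m k d V" "i < m" "X \<in> carrier_mat (k i) d"
  shows "cross_op m d (V(i := X)) (V(i := X))
    = cross_op m d V V + (mat_adjoint X * X - mat_adjoint (V i) * V i)"
  using assms
proof (induction m)
  case (Suc m)
  then have s: "is_system m k d V" "V m \<in> carrier_mat (k m) d" by (auto simp: is_system_Suc)
  have sys: "is_system (Suc m) k d (V(i := X))" using Suc.prems by (auto simp: is_system_def)
  have Vi: "V i \<in> carrier_mat (k i) d" using Suc.prems by (auto simp: is_system_def)
  note c = cross_op_carrier[OF s(1,1)] adjoint_mult_carrier[OF Suc.prems(3,3)]
    adjoint_mult_carrier[OF Vi Vi] adjoint_mult_carrier[OF s(2,2)]
  show ?case
  proof (cases "i = m")
    case True
    have "cross_op m d (V(i := X)) (V(i := X)) = cross_op m d V V"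
      using True by (intro cross_op_cong) auto
    moreover have "A + B = A + C + (B - C)"
      if "A \<in> carrier_mat d d" "B \<in> carrier_mat d d" "C \<in> carrier_mat d d" for A B C :: "complex mat"
      by (rule eq_matI) (use that in auto)
    ultimately show ?thesis
      unfolding cross_op_Suc[OF sys sys] cross_op_Suc[OF Suc.prems(1,1)]
      using True c by (metis fun_upd_same)
  next
    case False
    then have "i < m" using Suc.prems by simp
    from Suc.IH[OF s(1) this Suc.prems(3)]
    have "cross_op m d (V(i := X)) (V(i := X)) + mat_adjoint (V m) * V m
      = cross_op m d V V + (mat_adjoint X * X - mat_adjoint (V i) * V i) + mat_adjoint (V m) * V m"
      by (rule arg_cong)
    moreover have "A + (B - C) + D = A + D + (B - C)"
      if "A \<in> carrier_mat d d" "B \<in> carrier_mat d d" "C \<in> carrier_mat d d" "D \<in> carrier_mat d d"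
      for A B C D :: "complex mat"
      by (rule eq_matI) (use that in auto)
    ultimately show ?thesis
      unfolding cross_op_Suc[OF sys sys] cross_op_Suc[OF Suc.prems(1,1)]
      using c fun_upd_other[of m i V X] False by simp
  qed
qed simp

text \<open>Used to pass from the operator to the system: a vanishing frame operator has trace 0, so
  all the Frobenius norms vanish, and with them all members.\<close>

lemma mtrace_cross_op_self:
  assumes "is_system m k d V"
  shows "mtrace (cross_op m d V V) = complex_of_real (\<Sum>i<m. frob_sq (V i))"
  using assms
proof (induction m)
  case 0
  then show ?case by (simp add: mtrace_def)
next
  case (Suc m)
  then have s: "is_system m k d V" "V m \<in> carrier_mat (k m) d" by (auto simp: is_system_Suc)
  then show ?case
    unfolding cross_op_Suc[OF Suc.prems Suc.prems] using Suc.IH[OF s(1)]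
    by (subst mtrace_add[OF cross_op_carrier[OF s(1,1)] adjoint_mult_carrier[OF s(2,2)]])
      (simp add: mtrace_adjoint_mult_self)
qed

text \<open>Positive semidefiniteness, in a form that needs no spectral theory.\<close>

definition gram :: "nat \<Rightarrow> complex mat \<Rightarrow> bool" where
  "gram d A \<longleftrightarrow> (\<exists>m k V. is_system m k d V \<and> A = rs_op m d V)"

lemma gram_rs_op: "is_system m k d V \<Longrightarrow> gram d (rs_op m d V)"
  unfolding gram_def by blast

lemma gram_carrier: "gram d A \<Longrightarrow> A \<in> carrier_mat d d"
  unfolding gram_def rs_op_eq_cross_op by (auto intro: cross_op_carrier)

lemma gram_adjoint: "gram d A \<Longrightarrow> mat_adjoint A = A"
  unfolding gram_def rs_op_eq_cross_op using mat_adjoint_cross_op by blast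

text \<open>\<open>T\<^sup>* S\<^sub>V T\<close> is the frame operator of the system
  \<open>V\<^sub>i T\<close>.\<close>

lemma gram_conj:
  assumes "gram d A" "T \<in> carrier_mat d d"
  shows "gram d (mat_adjoint T * A * T)"
  using assms cross_op_conj[OF _ assms(2)] is_system_mult[OF _ assms(2)]
  unfolding gram_def rs_op_eq_cross_op by metis

lemma gram_adjoint_mult_self:
  assumes "X \<in> carrier_mat n d"
  shows "gram d (mat_adjoint X * X)"
proof -
  have "is_system (Suc 0) (\<lambda>_. n) d (\<lambda>_. X)" using assms by (simp add: is_system_def)
  moreover from cross_op_Suc[OF this this]
  have "mat_adjoint X * X = rs_op (Suc 0) d (\<lambda>_. X)"
    using adjoint_mult_carrier[OF assms assms] by (simp add: rs_op_eq_cross_op)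
  ultimately show ?thesis unfolding gram_def by blast
qed

text \<open>Both factors are sums of squares, and \<open>tr (X\<^sup>* X Y\<^sup>* Y)\<close> is the
  squared Frobenius norm of \<open>X Y\<^sup>*\<close>. First \<open>B\<close> is expanded against
  one fixed summand of \<open>A\<close>, then \<open>A\<close> itself.\<close>

lemma mtrace_gram_mult_nonneg:
  assumes "gram d A" "gram d B"
  shows "0 \<le> Re (mtrace (A * B))"
proof -
  obtain m k V where V: "is_system m k d V" and A: "A = cross_op m d V V"
    using assms(1) unfolding gram_def rs_op_eq_cross_op by blast
  have B: "B \<in> carrier_mat d d" using assms(2) by (rule gram_carrier)
  have one: "0 \<le> Re (mtrace (mat_adjoint X * X * B))" if X: "X \<in> carrier_mat n d" for X n
  proof -
    obtain m' k' W where W: "is_system m' k' d W" and BW: "B = cross_op m' d W W"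
      using assms(2) unfolding gram_def rs_op_eq_cross_op by blast
    show ?thesis using W B unfolding BW
    proof (induction m')
      case 0
      then show ?case using right_mult_zero_mat[OF adjoint_mult_carrier[OF X X]]
        by (simp add: mtrace_def)
    next
      case (Suc j)
      then have s: "is_system j k' d W" "W j \<in> carrier_mat (k' j) d" by (auto simp: is_system_Suc)
      let ?G = "mat_adjoint X * X"
      note c = adjoint_mult_carrier[OF X X] cross_op_carrier[OF s(1,1)] adjoint_mult_carrier[OF s(2,2)]
      have XW: "X * mat_adjoint (W j) \<in> carrier_mat n (k' j)" using X s by auto
      have "?G * (mat_adjoint (W j) * W j) = mat_adjoint X * (X * mat_adjoint (W j) * W j)"
        using assoc_mult_mat[of "mat_adjoint X" d n X d "mat_adjoint (W j) * W j" d]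
          assoc_mult_mat[of X n d "mat_adjoint (W j)" "k' j" "W j" d] X s c(3)
        by simp
      then have "mtrace (?G * (mat_adjoint (W j) * W j))
          = mtrace (mat_adjoint X * (X * mat_adjoint (W j) * W j))" by simp
      also have "\<dots> = mtrace (X * mat_adjoint (W j) * W j * mat_adjoint X)"
        by (rule mtrace_comm[of _ d n]) (use X s XW in auto)
      also have "X * mat_adjoint (W j) * W j * mat_adjoint X
          = (X * mat_adjoint (W j)) * (W j * mat_adjoint X)"
        using XW X s by (intro assoc_mult_mat[of _ n "k' j" _ d _ n]) auto
      also have "mtrace \<dots> = mtrace ((W j * mat_adjoint X) * (X * mat_adjoint (W j)))"
        by (rule mtrace_comm[of _ n "k' j"]) (use X s XW in auto)
      also have "W j * mat_adjoint X = mat_adjoint (X * mat_adjoint (W j))"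
        by (subst mat_adjoint_mult[of _ n d _ "k' j"]) (use X s in auto)
      finally have tr: "mtrace (?G * (mat_adjoint (W j) * W j))
          = complex_of_real (frob_sq (X * mat_adjoint (W j)))"
        by (simp add: mtrace_adjoint_mult_self)
      have "?G * cross_op (Suc j) d W W = ?G * cross_op j d W W + ?G * (mat_adjoint (W j) * W j)"
        unfolding cross_op_Suc[OF Suc.prems(1,1)] by (rule mult_add_distrib_mat[OF c])
      then have "mtrace (?G * cross_op (Suc j) d W W)
          = mtrace (?G * cross_op j d W W) + mtrace (?G * (mat_adjoint (W j) * W j))"
        using mtrace_add[OF mult_carrier_mat[OF c(1,2)] mult_carrier_mat[OF c(1,3)]] by simp
      then show ?case
        using Suc.IH[OF s(1) c(2)] frob_sq_nonneg tr by simp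
    qed
  qed
  show ?thesis using V unfolding A
  proof (induction m)
    case 0
    then show ?case using left_mult_zero_mat[OF B] by (simp add: mtrace_def)
  next
    case (Suc j)
    then have s: "is_system j k d V" "V j \<in> carrier_mat (k j) d" by (auto simp: is_system_Suc)
    note c = cross_op_carrier[OF s(1,1)] adjoint_mult_carrier[OF s(2,2)]
    have "mtrace (cross_op (Suc j) d V V * B)
        = mtrace (cross_op j d V V * B) + mtrace (mat_adjoint (V j) * V j * B)"
      unfolding cross_op_Suc[OF Suc.prems Suc.prems] add_mult_distrib_mat[OF c B]
      by (rule mtrace_add[OF mult_carrier_mat[OF c(1) B] mult_carrier_mat[OF c(2) B]])
    then show ?case using Suc.IH[OF s(1)] one[OF s(2)] by simp
  qed
qed

section \<open>Inverses, determinants and duality\<close>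

text \<open>Total (it is 0 on singular matrices), so that \<open>t \<mapsto> minv (F t)\<close> is defined off the invertible set.\<close>

definition minv :: "complex mat \<Rightarrow> complex mat" where
  "minv A = (1 / det A) \<cdot>\<^sub>m adj_mat A"

lemma minv_carrier [simp]: "A \<in> carrier_mat n n \<Longrightarrow> minv A \<in> carrier_mat n n"
  unfolding minv_def by (intro smult_carrier_mat adj_mat(1))

lemma minv:
  assumes A: "A \<in> carrier_mat n n" and det: "det A \<noteq> 0"
  shows "A * minv A = 1\<^sub>m n" "minv A * A = 1\<^sub>m n"
proof -
  show "A * minv A = 1\<^sub>m n"
    unfolding minv_def mult_smult_distrib[OF A adj_mat(1)[OF A]] adj_mat(2)[OF A]
    by (rule eq_matI) (use det in auto)
  show "minv A * A = 1\<^sub>m n"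
    unfolding minv_def mult_smult_assoc_mat[OF adj_mat(1)[OF A] A] adj_mat(3)[OF A]
    by (rule eq_matI) (use det in auto)
qed

lemma invertible_mat_iff_det:
  fixes A :: "complex mat"
  assumes A: "A \<in> carrier_mat n n"
  shows "invertible_mat A \<longleftrightarrow> det A \<noteq> 0"
proof
  assume "invertible_mat A"
  then obtain B where B: "A * B = 1\<^sub>m n" "B * A = 1\<^sub>m (dim_row B)"
    using A unfolding invertible_mat_def inverts_mat_def by auto
  \<comment> \<open>\<open>invertible_mat\<close> yields a two-sided inverse of unspecified shape;
    its dimensions are read off from the two products.\<close>
  have "dim_col B = n" using arg_cong[OF B(1), of dim_col] by simp
  moreover have "dim_row B = n" using arg_cong[OF B(2), of dim_col] A by simp
  ultimately have "B \<in> carrier_mat n n" by auto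
  from det_mult[OF A this] B(1) show "det A \<noteq> 0" by auto
next
  assume "det A \<noteq> 0"
  note inv = minv[OF A this]
  have "inverts_mat A (minv A)" "inverts_mat (minv A) A"
    unfolding inverts_mat_def carrier_matD[OF A] carrier_matD[OF minv_carrier[OF A]] by (fact inv)+
  moreover have "square_mat A" using A by simp
  ultimately show "invertible_mat A" unfolding invertible_mat_def by blast
qed

text \<open>If \<open>S\<^sub>W x = 0\<close>, then pairing with \<open>x\<close> gives
  \<open>W\<^sub>i x = 0\<close> for all \<open>i\<close>, and duality recovers \<open>x\<close> as
  the sum of the \<open>V\<^sub>i\<^sup>* W\<^sub>i x\<close>, so \<open>x = 0\<close>.\<close>

lemma invertible_rs_op_of_dual:
  assumes V: "is_system m k d V" and W: "is_system m k d W" and dual: "cross_op m d W V = 1\<^sub>m d"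
  shows "invertible_mat (rs_op m d W)"
proof -
  note S = cross_op_carrier[OF W W]
  have "det (cross_op m d W W) \<noteq> 0"
  proof
    assume "det (cross_op m d W W) = 0"
    then obtain x where x: "x \<in> carrier_vec d" "x \<noteq> 0\<^sub>v d" "cross_op m d W W *\<^sub>v x = 0\<^sub>v d"
      using det_0_iff_vec_prod_zero_field[OF S] by blast
    \<comment> \<open>The kernel vector is repeated in every column of a square matrix, so that the
      trace identity for the system \<open>W\<^sub>i X\<close> does the work of the inner product
      with \<open>x\<close>.\<close>
    define X where "X = mat d d (\<lambda>(i, j). x $ i)"
    have X: "X \<in> carrier_mat d d" unfolding X_def by simp
    have col: "col X j = x" if "j < d" for j
      using x(1) that unfolding X_def by (intro eq_vecI) auto
    have "cross_op m d W W * X = 0\<^sub>m d d"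
    proof (rule eq_matI)
      fix i j assume ij: "i < dim_row (0\<^sub>m d d :: complex mat)" "j < dim_col (0\<^sub>m d d :: complex mat)"
      then have "(cross_op m d W W * X) $$ (i, j) = (cross_op m d W W *\<^sub>v x) $ i"
        using S X col by simp
      then show "(cross_op m d W W * X) $$ (i, j) = 0\<^sub>m d d $$ (i, j)"
        using x(3) ij by simp
    qed (use S X in auto)
    then have "cross_op m d (\<lambda>i. W i * X) (\<lambda>i. W i * X) = 0\<^sub>m d d"
      using X S unfolding cross_op_conj[OF W X]
      by (subst assoc_mult_mat[of _ d d _ d _ d]) auto
    then have "(\<Sum>i<m. frob_sq (W i * X)) = 0"
      using mtrace_cross_op_self[OF is_system_mult[OF W X]]
      by (simp add: mtrace_def flip: of_real_sum)
    then have "\<forall>i<m. frob_sq (W i * X) = 0"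
      by (subst (asm) sum_nonneg_eq_0_iff) (auto simp: frob_sq_nonneg)
    then have WX: "\<forall>i<m. W i * X = 0\<^sub>m (k i) d"
      using is_system_mult[OF W X] frob_sq_eq_0 unfolding is_system_def by blast
    have VW: "cross_op m d V W = 1\<^sub>m d"
      using mat_adjoint_cross_op[OF W V] dual by simp
    have "X = cross_op m d V (\<lambda>i. W i * X)"
      using X unfolding cross_op_mult_right[OF V W X] VW by simp
    also have "\<dots> = cross_op m d V (\<lambda>i. W i * 0\<^sub>m d d)"
      using WX W by (intro cross_op_cong refl) (auto simp: is_system_def)
    also have "\<dots> = 0\<^sub>m d d"
      using cross_op_mult_right[OF V W] cross_op_carrier[OF V W] by simp
    finally have X0: "X = 0\<^sub>m d d" .
    have "x = 0\<^sub>v d"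
    proof (rule eq_vecI)
      fix i assume i: "i < dim_vec (0\<^sub>v d :: complex vec)"
      then have "x $ i = X $$ (i, i)" unfolding X_def by simp
      then show "x $ i = 0\<^sub>v d $ i" using i unfolding X0 by simp
    qed (use x in auto)
    with x(2) show False ..
  qed
  then show ?thesis
    using invertible_mat_iff_det[OF S] by (simp add: rs_op_eq_cross_op)
qed

subsection \<open>Derivatives of matrix curves at 0\<close>

text \<open>Entrywise and only at 0; the parameter is real and the entries are complex, hence vector
  derivatives. The shape is fixed for every \<open>t\<close>, which keeps the algebraic rules free
  of side conditions on \<open>t\<close>.\<close>

definition has_mat_deriv ::
  "nat \<Rightarrow> nat \<Rightarrow> (real \<Rightarrow> complex mat) \<Rightarrow> complex mat \<Rightarrow> bool" where
  "has_mat_deriv n p F F' \<longleftrightarrow> (\<forall>t. F t \<in> carrier_mat n p) \<and> F' \<in> carrier_mat n p \<and>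
    (\<forall>i<n. \<forall>j<p. ((\<lambda>t. F t $$ (i, j)) has_vector_derivative F' $$ (i, j)) (at 0))"

lemma has_mat_derivD:
  assumes "has_mat_deriv n p F F'"
  shows "F t \<in> carrier_mat n p" "F' \<in> carrier_mat n p"
    "i < n \<Longrightarrow> j < p \<Longrightarrow> ((\<lambda>t. F t $$ (i, j)) has_vector_derivative F' $$ (i, j)) (at 0)"
  using assms unfolding has_mat_deriv_def by auto

lemma has_mat_deriv_tendsto:
  assumes "has_mat_deriv n p F F'" "i < n" "j < p"
  shows "((\<lambda>t. F t $$ (i, j)) \<longlongrightarrow> F 0 $$ (i, j)) (nhds 0)"
  using has_vector_derivative_continuous[OF has_mat_derivD(3)[OF assms]]
  by (simp add: isCont_def tendsto_nhds_iff)

lemma has_mat_deriv_const: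
  "A \<in> carrier_mat n p \<Longrightarrow> has_mat_deriv n p (\<lambda>_. A) (0\<^sub>m n p)"
  unfolding has_mat_deriv_def by auto

lemma has_mat_deriv_smult:
  assumes "A \<in> carrier_mat n p"
  shows "has_mat_deriv n p (\<lambda>t. complex_of_real (c * t) \<cdot>\<^sub>m A) (complex_of_real c \<cdot>\<^sub>m A)"
proof -
  have "((\<lambda>t. complex_of_real (c * t) * a) has_vector_derivative complex_of_real c * a) (at 0)" for a
  proof -
    have "((\<lambda>t. t *\<^sub>R (complex_of_real c * a)) has_vector_derivative 1 *\<^sub>R (complex_of_real c * a)) (at 0)"
      by (auto intro!: derivative_eq_intros simp: has_vector_derivative_def)
    then show ?thesis by (simp add: scaleR_conv_of_real mult_ac)
  qed
  then show ?thesis using assms unfolding has_mat_deriv_def by auto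
qed

lemma has_mat_deriv_add:
  assumes "has_mat_deriv n p F F'" "has_mat_deriv n p G G'"
  shows "has_mat_deriv n p (\<lambda>t. F t + G t) (F' + G')"
proof -
  have "((\<lambda>t. (F t + G t) $$ (i, j)) has_vector_derivative (F' + G') $$ (i, j)) (at 0)"
    if "i < n" "j < p" for i j
    using has_vector_derivative_add[OF has_mat_derivD(3)[OF assms(1) that] has_mat_derivD(3)[OF assms(2) that]]
      that
    by (simp add: carrier_matD[OF has_mat_derivD(1)[OF assms(2)]] carrier_matD[OF has_mat_derivD(2)[OF assms(2)]])
  then show ?thesis
    using has_mat_derivD(1,2)[OF assms(1)] has_mat_derivD(1,2)[OF assms(2)]
    unfolding has_mat_deriv_def by (auto intro: add_carrier_mat)
qed

lemma has_mat_deriv_minus: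
  assumes "has_mat_deriv n p F F'" "has_mat_deriv n p G G'"
  shows "has_mat_deriv n p (\<lambda>t. F t - G t) (F' - G')"
proof -
  have "((\<lambda>t. (F t - G t) $$ (i, j)) has_vector_derivative (F' - G') $$ (i, j)) (at 0)"
    if "i < n" "j < p" for i j
    using has_vector_derivative_diff[OF has_mat_derivD(3)[OF assms(1) that] has_mat_derivD(3)[OF assms(2) that]]
      that
    by (simp add: carrier_matD[OF has_mat_derivD(1)[OF assms(2)]] carrier_matD[OF has_mat_derivD(2)[OF assms(2)]])
  then show ?thesis
    using has_mat_derivD(1,2)[OF assms(1)] has_mat_derivD(1,2)[OF assms(2)]
    unfolding has_mat_deriv_def by (auto intro: minus_carrier_mat)
qed

lemma has_mat_deriv_adjoint:
  assumes "has_mat_deriv n p F F'"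
  shows "has_mat_deriv p n (\<lambda>t. mat_adjoint (F t)) (mat_adjoint F')"
proof -
  have "((\<lambda>t. mat_adjoint (F t) $$ (i, j)) has_vector_derivative mat_adjoint F' $$ (i, j)) (at 0)"
    if "i < p" "j < n" for i j
    using bounded_linear.has_vector_derivative[OF bounded_linear_cnj has_mat_derivD(3)[OF assms that(2,1)]] that
    by (simp add: carrier_matD[OF has_mat_derivD(1)[OF assms]] carrier_matD[OF has_mat_derivD(2)[OF assms]])
  then show ?thesis
    using has_mat_derivD(1,2)[OF assms] unfolding has_mat_deriv_def by auto
qed

lemma has_mat_deriv_mult:
  assumes "has_mat_deriv n p F F'" "has_mat_deriv p q G G'"
  shows "has_mat_deriv n q (\<lambda>t. F t * G t) (F 0 * G' + F' * G 0)"
proof -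
  note c = has_mat_derivD(1,2)[OF assms(1)] has_mat_derivD(1,2)[OF assms(2)]
  have "((\<lambda>t. (F t * G t) $$ (i, j)) has_vector_derivative (F 0 * G' + F' * G 0) $$ (i, j)) (at 0)"
    if ij: "i < n" "j < q" for i j
  proof -
    have "((\<lambda>t. \<Sum>l<p. F t $$ (i, l) * G t $$ (l, j)) has_vector_derivative
      (\<Sum>l<p. F 0 $$ (i, l) * G' $$ (l, j) + F' $$ (i, l) * G 0 $$ (l, j))) (at 0)"
      using ij by (intro has_vector_derivative_sum has_vector_derivative_mult has_mat_derivD(3)[OF assms(1)]
        has_mat_derivD(3)[OF assms(2)]) auto
    moreover have "(F 0 * G' + F' * G 0) $$ (i, j)
        = (\<Sum>l<p. F 0 $$ (i, l) * G' $$ (l, j) + F' $$ (i, l) * G 0 $$ (l, j))"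
      using ij mult_mat_index[OF c(1,4) ij] mult_mat_index[OF c(2,3) ij]
        carrier_matD[OF c(2)] carrier_matD[OF c(3)]
      by (simp add: sum.distrib del: index_mult_mat(1))
    ultimately show ?thesis unfolding mult_mat_index[OF c(1,3) ij] by simp
  qed
  then show ?thesis
    using c unfolding has_mat_deriv_def by (auto intro!: add_carrier_mat mult_carrier_mat)
qed

text \<open>Serves to differentiate an identity that holds only near 0, namely
  \<open>F t * minv (F t) = 1\<^sub>m n\<close>.\<close>

lemma has_mat_deriv_eventually_const:
  assumes F: "has_mat_deriv n p F F'" and ev: "\<forall>\<^sub>F t in nhds 0. F t = A"
  shows "F' = 0\<^sub>m n p"
proof (rule eq_matI)
  note c = has_mat_derivD(1,2)[OF F]
  fix i j assume "i < dim_row (0\<^sub>m n p :: complex mat)" "j < dim_col (0\<^sub>m n p :: complex mat)"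
  then have ij: "i < n" "j < p" by auto
  have "((\<lambda>t. A $$ (i, j)) has_derivative (\<lambda>x. x *\<^sub>R F' $$ (i, j))) (at 0)"
  proof (rule has_derivative_transform_eventually)
    show "((\<lambda>t. F t $$ (i, j)) has_derivative (\<lambda>x. x *\<^sub>R F' $$ (i, j))) (at 0)"
      using has_mat_derivD(3)[OF F ij] unfolding has_vector_derivative_def .
    show "\<forall>\<^sub>F t in at 0. F t $$ (i, j) = A $$ (i, j)"
      unfolding eventually_at_filter using ev by (rule eventually_mono) simp
    show "F 0 $$ (i, j) = A $$ (i, j)"
      using eventually_nhds_x_imp_x[OF ev] by simp
  qed simp
  from has_derivative_unique[OF this has_derivative_const]
  have "1 *\<^sub>R F' $$ (i, j) = 0" by meson
  then show "F' $$ (i, j) = 0\<^sub>m n p $$ (i, j)" using ij by simp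
qed (use has_mat_derivD(2)[OF F] in auto)

section \<open>Determinant and inverse along a curve\<close>

text \<open>By the Leibniz formula the determinant is a polynomial in the entries. Its derivative is
  never computed: differentiability suffices for continuity at 0 and for the inverse.\<close>

lemma differentiable_det:
  fixes F :: "real \<Rightarrow> complex mat"
  assumes F: "\<And>t. F t \<in> carrier_mat n n"
    and diff: "\<And>i j. i < n \<Longrightarrow> j < n \<Longrightarrow> (\<lambda>t. F t $$ (i, j)) differentiable (at 0)"
  shows "(\<lambda>t. det (F t)) differentiable (at 0)"
proof -
  have prod: "(\<lambda>t. \<Prod>i\<in>{0..<n}. F t $$ (i, p i)) differentiable (at 0)" if "p permutes {0..<n}" for p
  proof -
    have "\<forall>i\<in>{0..<n}. \<exists>D. ((\<lambda>t. F t $$ (i, p i)) has_derivative D) (at 0)"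
      using diff permutes_in_image[OF that] unfolding differentiable_def by auto
    from bchoice[OF this] obtain D
      where "\<forall>i\<in>{0..<n}. ((\<lambda>t. F t $$ (i, p i)) has_derivative D i) (at 0)" by blast
    then have "((\<lambda>t. \<Prod>i\<in>{0..<n}. F t $$ (i, p i)) has_derivative
        (\<lambda>y. \<Sum>i\<in>{0..<n}. D i y * (\<Prod>j\<in>{0..<n} - {i}. F 0 $$ (j, p j)))) (at 0)"
      by (intro has_derivative_prod) auto
    then show ?thesis unfolding differentiable_def by blast
  qed
  show ?thesis
    unfolding det_def'[OF F]
    by (intro differentiable_sum ballI differentiable_mult differentiable_const prod)
      (auto simp: finite_permutations)
qed

lemma has_mat_deriv_differentiable:
  assumes "has_mat_deriv n p F F'" "i < n" "j < p"
  shows "(\<lambda>t. F t $$ (i, j)) differentiable (at 0)"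
  using has_mat_derivD(3)[OF assms] unfolding differentiable_def has_vector_derivative_def by blast

lemma eventually_det_neq_0:
  assumes F: "has_mat_deriv n n F F'" and det: "det (F 0) \<noteq> 0"
  shows "\<forall>\<^sub>F t in nhds 0. det (F t) \<noteq> 0"
proof -
  have "(\<lambda>t. det (F t)) differentiable (at 0)"
    using has_mat_derivD(1)[OF F] has_mat_deriv_differentiable[OF F] by (rule differentiable_det)
  then have "isCont (\<lambda>t. det (F t)) 0"
    unfolding differentiable_def by (auto intro: has_derivative_continuous)
  then have "((\<lambda>t. det (F t)) \<longlongrightarrow> det (F 0)) (nhds 0)"
    by (simp add: isCont_def tendsto_nhds_iff)
  then show ?thesis using det by (rule tendsto_imp_eventually_ne)
qed

text \<open>The adjugate formula makes the entries quotients of determinants, hence differentiable.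
  The value of the derivative is then forced by differentiating
  \<open>F t * minv (F t) = 1\<^sub>m n\<close> and multiplying by the inverse from the
  left.\<close>

lemma has_mat_deriv_minv:
  assumes F: "has_mat_deriv n n F F'" and det: "det (F 0) \<noteq> 0"
  shows "has_mat_deriv n n (\<lambda>t. minv (F t)) (- (minv (F 0) * F' * minv (F 0)))"
proof -
  note c = has_mat_derivD(1,2)[OF F]
  have diff: "(\<lambda>t. minv (F t) $$ (i, j)) differentiable (at 0)" if ij: "i < n" "j < n" for i j
  proof -
    \<comment> \<open>The entries of a minor are entries of \<open>F t\<close> with indices shifted
      past the deleted row \<open>j\<close> and column \<open>i\<close>. Row and column are
      exchanged because the adjugate is the transposed cofactor matrix.\<close>
    have "(\<lambda>t. F t $$ (if i' < j then i' else Suc i', if j' < i then j' else Suc j'))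
        differentiable (at 0)" if "i' < n - 1" "j' < n - 1" for i' j'
      using that by (intro has_mat_deriv_differentiable[OF F]) auto
    then have "(\<lambda>t. mat_delete (F t) j i $$ (i', j')) differentiable (at 0)"
      if "i' < n - 1" "j' < n - 1" for i' j'
      using that carrier_matD[OF c(1)] unfolding mat_delete_def by simp
    then have "(\<lambda>t. det (mat_delete (F t) j i)) differentiable (at 0)"
      using mat_delete_carrier[OF c(1)] by (intro differentiable_det)
    moreover have "(\<lambda>t. det (F t)) differentiable (at 0)"
      using c(1) has_mat_deriv_differentiable[OF F] by (rule differentiable_det)
    ultimately have "(\<lambda>t. 1 / det (F t) * ((-1) ^ (j + i) * det (mat_delete (F t) j i)))
        differentiable (at 0)"
      using det by (intro differentiable_mult differentiable_divide differentiable_const)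
    moreover have "minv (F t) $$ (i, j) = 1 / det (F t) * ((-1) ^ (j + i) * det (mat_delete (F t) j i))" for t
      using ij carrier_matD[OF c(1)] unfolding minv_def adj_mat_def cofactor_def by simp
    ultimately show ?thesis by simp
  qed
  have "\<exists>D. ((\<lambda>t. minv (F t) $$ (i, j)) has_vector_derivative D) (at 0)" if ij: "i < n" "j < n" for i j
  proof -
    obtain D where D: "((\<lambda>t. minv (F t) $$ (i, j)) has_derivative D) (at 0)"
      using diff[OF ij] unfolding differentiable_def by blast
    \<comment> \<open>A linear map on the real line is determined by its value at 1; this converts
      the Frechet derivative into a vector derivative.\<close>
    have "D = (\<lambda>x. x *\<^sub>R D 1)"
    proof
      fix x show "D x = x *\<^sub>R D 1"
        using linear_scale[OF has_derivative_linear[OF D], of x 1] by simp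
    qed
    then show ?thesis
      unfolding has_vector_derivative_def by (intro exI[of _ "D 1"] has_derivative_eq_rhs[OF D])
  qed
  note ex = this
  \<comment> \<open>So far the entry derivatives are only known to exist; chosen ones are collected
    in \<open>R'\<close>, which is identified afterwards.\<close>
  define D where "D i j = (SOME D. ((\<lambda>t. minv (F t) $$ (i, j)) has_vector_derivative D) (at 0))" for i j
  have D: "((\<lambda>t. minv (F t) $$ (i, j)) has_vector_derivative D i j) (at 0)" if "i < n" "j < n" for i j
    unfolding D_def by (rule someI_ex[OF ex[OF that]])
  define R' where "R' = mat n n (\<lambda>(i, j). D i j)"
  have R: "has_mat_deriv n n (\<lambda>t. minv (F t)) R'"
    unfolding has_mat_deriv_def R'_def using minv_carrier[OF c(1)] D by auto
  note cR = has_mat_derivD(1,2)[OF R]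
  have "\<forall>\<^sub>F t in nhds 0. F t * minv (F t) = 1\<^sub>m n"
    using eventually_det_neq_0[OF F det] by eventually_elim (use c(1) in \<open>rule minv(1)\<close>)
  from has_mat_deriv_eventually_const[OF has_mat_deriv_mult[OF F R] this]
  have 0: "F 0 * R' + F' * minv (F 0) = 0\<^sub>m n n" .
  have "minv (F 0) * (F 0 * R') + minv (F 0) * (F' * minv (F 0)) = 0\<^sub>m n n"
    using arg_cong[OF 0, of "\<lambda>A. minv (F 0) * A"]
      mult_add_distrib_mat[OF cR(1)[of 0] mult_carrier_mat[OF c(1)[of 0] cR(2)] mult_carrier_mat[OF c(2) cR(1)[of 0]]]
      right_mult_zero_mat[OF cR(1)[of 0]] by simp
  moreover have "minv (F 0) * (F 0 * R') = R'"
    using assoc_mult_mat[OF cR(1)[of 0] c(1)[of 0] cR(2)] minv(2)[OF c(1)[of 0] det]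
      left_mult_one_mat[OF cR(2)] by simp
  moreover have "minv (F 0) * (F' * minv (F 0)) = minv (F 0) * F' * minv (F 0)"
    by (rule assoc_mult_mat[symmetric, OF cR(1) c(2) cR(1)])
  ultimately have sum: "R' + minv (F 0) * F' * minv (F 0) = 0\<^sub>m n n" by simp
  have cM: "minv (F 0) * F' * minv (F 0) \<in> carrier_mat n n"
    by (rule mult_carrier_mat[OF mult_carrier_mat[OF cR(1) c(2)] cR(1)])
  have "R' = - (minv (F 0) * F' * minv (F 0))"
  proof (rule eq_matI)
    fix i j assume "i < dim_row (- (minv (F 0) * F' * minv (F 0)))"
      "j < dim_col (- (minv (F 0) * F' * minv (F 0)))"
    then have ij: "i < n" "j < n" using carrier_matD[OF cM] by auto
    have "R' $$ (i, j) + (minv (F 0) * F' * minv (F 0)) $$ (i, j) = 0"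
      using arg_cong[OF sum, of "\<lambda>A. A $$ (i, j)"] ij carrier_matD[OF cM] carrier_matD[OF cR(2)]
      by (simp del: index_mult_mat)
    then show "R' $$ (i, j) = (- (minv (F 0) * F' * minv (F 0))) $$ (i, j)"
      using ij carrier_matD[OF cM] by (simp add: eq_neg_iff_add_eq_0 del: index_mult_mat)
  qed (use carrier_matD[OF cM] carrier_matD[OF cR(2)] in \<open>simp_all del: index_mult_mat\<close>)
  with R show ?thesis by simp
qed

lemma has_mat_deriv_mtrace:
  assumes F: "has_mat_deriv n n F F'"
  shows "((\<lambda>t. mtrace (F t)) has_vector_derivative mtrace F') (at 0)"
  unfolding mtrace_def carrier_matD[OF has_mat_derivD(1)[OF F]] carrier_matD[OF has_mat_derivD(2)[OF F]]
  by (intro has_vector_derivative_sum has_mat_derivD(3)[OF F]) auto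

text \<open>The Cayley transform of \<open>(t/2) X\<close>: unlike the exponential it needs only a matrix inverse.\<close>

lemma unitary_path:
  assumes X: "X \<in> carrier_mat d d" and skew: "mat_adjoint X = - X"
  obtains U where "has_mat_deriv d d U X" "U 0 = 1\<^sub>m d"
    "\<forall>\<^sub>F t in nhds 0. U t * mat_adjoint (U t) = 1\<^sub>m d"
proof -
  \<comment> \<open>The numerator and the inverted denominator each contribute half of
    \<open>X\<close> to the derivative of \<open>U\<close> at 0.\<close>
  define P where "P t = 1\<^sub>m d + complex_of_real (1/2 * t) \<cdot>\<^sub>m X" for t
  define N where "N t = 1\<^sub>m d + complex_of_real (-1/2 * t) \<cdot>\<^sub>m X" for t
  define U where "U t = P t * minv (N t)" for t
  have cP: "P t \<in> carrier_mat d d" and cN: "N t \<in> carrier_mat d d" for t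
    using X by (auto simp: P_def N_def)
  have P0: "P 0 = 1\<^sub>m d" and N0: "N 0 = 1\<^sub>m d"
    using X by (auto simp: P_def N_def intro!: eq_matI)
  have mP: "has_mat_deriv d d P (0\<^sub>m d d + complex_of_real (1/2) \<cdot>\<^sub>m X)"
    unfolding P_def by (intro has_mat_deriv_add has_mat_deriv_const has_mat_deriv_smult X one_carrier_mat)
  have mN: "has_mat_deriv d d N (0\<^sub>m d d + complex_of_real (-1/2) \<cdot>\<^sub>m X)"
    unfolding N_def by (intro has_mat_deriv_add has_mat_deriv_const has_mat_deriv_smult X one_carrier_mat)
  have det0: "det (N 0) \<noteq> 0" unfolding N0 by simp
  have I: "minv (1\<^sub>m d) = 1\<^sub>m d"
    using minv(1)[OF one_carrier_mat] left_mult_one_mat[OF minv_carrier[OF one_carrier_mat]]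
    by (metis det_one zero_neq_one)
  \<comment> \<open>As \<open>t\<close> is real, skewness of \<open>X\<close> makes the adjoint
    exchange numerator and denominator.\<close>
  have adjN: "mat_adjoint (N t) = P t" for t
    unfolding N_def P_def
    by (subst mat_adjoint_add[of _ d d]) (use X in \<open>auto simp: mat_adjoint_smult skew intro!: eq_matI\<close>)
  have adjP: "mat_adjoint (P t) = N t" for t
    using adjN[of t] mat_adjoint_mat_adjoint by metis
  have comm: "P t * N t = N t * P t" for t
    unfolding P_def N_def using X
    by (simp add: add_mult_distrib_mat[of _ d d _ _ d] mult_add_distrib_mat[of _ d d _ d]
        mult_smult_distrib[of _ d d _ d] mult_smult_assoc_mat[of _ d d _ d])
      (auto intro!: eq_matI simp: right_diff_distrib distrib_left simp del: index_mult_mat(1))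
  show ?thesis
  proof
    have "has_mat_deriv d d U (P 0 * - (minv (N 0) * (0\<^sub>m d d + complex_of_real (-1/2) \<cdot>\<^sub>m X) * minv (N 0))
        + (0\<^sub>m d d + complex_of_real (1/2) \<cdot>\<^sub>m X) * minv (N 0))"
      unfolding U_def by (intro has_mat_deriv_mult[OF mP] has_mat_deriv_minv[OF mN det0])
    also have "P 0 * - (minv (N 0) * (0\<^sub>m d d + complex_of_real (-1/2) \<cdot>\<^sub>m X) * minv (N 0))
        + (0\<^sub>m d d + complex_of_real (1/2) \<cdot>\<^sub>m X) * minv (N 0) = X"
      unfolding P0 N0 I using X by (auto intro!: eq_matI)
    finally show "has_mat_deriv d d U X" .
    show "U 0 = 1\<^sub>m d" unfolding U_def P0 N0 I by simp
    show "\<forall>\<^sub>F t in nhds 0. U t * mat_adjoint (U t) = 1\<^sub>m d"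
      using eventually_det_neq_0[OF mN det0]
    proof eventually_elim
      case (elim t)
      define C where "C = minv (N t)"
      have cC: "C \<in> carrier_mat d d" unfolding C_def by (rule minv_carrier[OF cN])
      have NC: "N t * C = 1\<^sub>m d" and CN: "C * N t = 1\<^sub>m d"
        unfolding C_def using minv[OF cN elim] by auto
      note a = assoc_mult_mat[of _ d d _ d _ d]
      \<comment> \<open>Since \<open>P t\<close> commutes with \<open>N t\<close>, it commutes with
        the inverse \<open>C\<close>. Writing \<open>U t\<close> as \<open>C * P t\<close> places
        \<open>P t\<close> next to \<open>mat_adjoint C\<close>, which is its inverse.\<close>
      have "C * (P t * N t) * C = C * (N t * P t) * C" unfolding comm ..
      moreover have "C * (P t * N t) * C = C * P t" using cC cP[of t] cN[of t] NC by (simp add: a)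
      moreover have "C * (N t * P t) = P t" using cC cP[of t] cN[of t] CN by (simp add: a[symmetric])
      ultimately have CP: "P t * C = C * P t" by simp
      have PC': "P t * mat_adjoint C = 1\<^sub>m d"
        using arg_cong[OF CN, of mat_adjoint] mat_adjoint_mult[OF cC cN[of t]] adjN by simp
      have "mat_adjoint (U t) = mat_adjoint C * N t"
        unfolding U_def C_def[symmetric] mat_adjoint_mult[OF cP cC] adjP ..
      moreover have "U t = C * P t" unfolding U_def C_def[symmetric] by (rule CP)
      ultimately have "U t * mat_adjoint (U t) = (C * P t) * (mat_adjoint C * N t)" by simp
      also have "\<dots> = C * (P t * mat_adjoint C * N t)"
        using cC cP[of t] cN[of t] by (simp add: a mult_carrier_mat[of _ d d _ d])
      also have "\<dots> = 1\<^sub>m d" unfolding PC' using cN[of t] CN by simp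
      finally show ?case .
    qed
  qed
qed

text \<open>The metric depends continuously on finitely many entries, so the entrywise calculus of
  curves yields closeness in \<open>dP\<close>.\<close>

lemma dP_tendsto_0:
  assumes V: "is_system m k d V" and F: "\<And>t. is_system m k d (F t)"
    and lim: "\<And>i a b. i < m \<Longrightarrow> a < k i \<Longrightarrow> b < d \<Longrightarrow> ((\<lambda>t. F t i $$ (a, b)) \<longlongrightarrow> V i $$ (a, b)) L"
  shows "((\<lambda>t. dP m V (F t)) \<longlongrightarrow> 0) L"
proof -
  have eq: "dP m V (F t) = sqrt (\<Sum>i<m. \<Sum>a<k i. \<Sum>b<d. (cmod (V i $$ (a, b) - F t i $$ (a, b)))\<^sup>2)" for t
  proof -
    have "frob_sq (V i - F t i) = (\<Sum>a<k i. \<Sum>b<d. (cmod (V i $$ (a, b) - F t i $$ (a, b)))\<^sup>2)"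
      if "i < m" for i
    proof -
      have "F t i \<in> carrier_mat (k i) d" using F that by (simp add: is_system_def)
      from carrier_matD[OF this] show ?thesis by (simp add: frob_sq_def)
    qed
    then show ?thesis unfolding dP_def by simp
  qed
  have "((\<lambda>t. sqrt (\<Sum>i<m. \<Sum>a<k i. \<Sum>b<d. (cmod (V i $$ (a, b) - F t i $$ (a, b)))\<^sup>2))
      \<longlongrightarrow> sqrt (\<Sum>i<m. \<Sum>a<k i. \<Sum>b<d. (cmod (V i $$ (a, b) - V i $$ (a, b)))\<^sup>2)) L"
    by (intro tendsto_real_sqrt tendsto_sum tendsto_power tendsto_norm tendsto_diff tendsto_const lim) auto
  then show ?thesis unfolding eq by simp
qed

subsection \<open>Critical points of the potential\<close>

text \<open>Self-adjointness of \<open>S\<close> gives \<open>R\<^sup>* S = 1\<close>, hence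
  \<open>R = R\<^sup>* S R\<close>, which \<open>gram_conj\<close> covers.\<close>

lemma gram_inverse:
  assumes S: "gram d S" and R: "R \<in> carrier_mat d d" and SR: "S * R = 1\<^sub>m d"
  shows "gram d R"
proof -
  note cS = gram_carrier[OF S]
  have "mat_adjoint R * S = 1\<^sub>m d"
    using arg_cong[OF SR, of mat_adjoint] mat_adjoint_mult[OF cS R] gram_adjoint[OF S] by simp
  then have "mat_adjoint R * S * R = R" using R by simp
  then show ?thesis using gram_conj[OF S R] by simp
qed

text \<open>\<open>crit\<close> is stationarity of
  \<open>tr S\<^sup>2 + tr S\<^sup>-\<^sup>2\<close> when \<open>S\<close> moves with velocity
  \<open>G * X - X * G\<close>, a factor 2 being removed. Its left side is the squared Frobenius
  norm of \<open>K\<close>, its right side is minus a sum of three nonnegative traces, so both are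
  0.\<close>

lemma commutator_eq_0_of_critical:
  fixes S R G :: "complex mat"
  defines "K \<equiv> S * G - G * S"
  defines "X \<equiv> mat_adjoint K"
  assumes S: "gram d S" and R: "R \<in> carrier_mat d d" and SR: "S * R = 1\<^sub>m d" and RS: "R * S = 1\<^sub>m d"
    and G: "G \<in> carrier_mat d d"
    and crit: "Re (mtrace (S * (G * X - X * G))) = Re (mtrace (R * (R * (G * X - X * G) * R)))"
  shows "S * G = G * S"
proof -
  note cS = gram_carrier[OF S]
  note gR = gram_inverse[OF S R SR]
  have K: "K \<in> carrier_mat d d" using cS G by (auto simp: K_def)
  have X: "X \<in> carrier_mat d d" using K by (simp add: X_def)
  note a = assoc_mult_mat[of _ d d _ d _ d]
  note dist = minus_mult_distrib_mat[of _ d d _ _ d] mult_minus_distrib_mat[of _ d d _ d]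
  note tr = mtrace_minus[of _ d]
  have RSZ: "R * (S * Z) = Z" if "Z \<in> carrier_mat d d" for Z
    using that cS R RS by (simp add: a[symmetric])
  \<comment> \<open>As \<open>R\<close> inverts \<open>S\<close>, conjugating turns
    \<open>[S, G]\<close> into \<open>[G, R]\<close>. The variant \<open>RKRZ\<close> lets this
    rewrite inside right-nested products.\<close>
  have RKR: "R * (K * R) = G * R - R * G"
  proof -
    have "K * R = S * (G * R) - G" unfolding K_def using cS R G SR by (simp add: dist a)
    then show ?thesis using cS R G RSZ by (simp add: dist)
  qed
  have RKRZ: "R * (K * (R * Z)) = G * (R * Z) - R * (G * Z)" if "Z \<in> carrier_mat d d" for Z
  proof -
    have "R * (K * (R * Z)) = (R * (K * R)) * Z" using that R K by (simp add: a)
    then show ?thesis unfolding RKR using that R G by (simp add: dist a)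
  qed
  \<comment> \<open>The sum of \<open>t1\<close>, \<open>t2\<close> and \<open>t3\<close> telescopes
    to \<open>tr (G R\<^sup>3 X) - tr (R\<^sup>3 G X)\<close>, the negative of the right side of
    \<open>l2\<close>.\<close>
  have t1: "mtrace (R * (R * (R * (K * (R * X))))) = mtrace (R * (R * (G * (R * X)))) - mtrace (R * (R * (R * (G * X))))"
    using R G X by (simp add: RKRZ dist tr)
  have t2: "mtrace (R * (R * (K * (R * (R * X))))) = mtrace (R * (G * (R * (R * X)))) - mtrace (R * (R * (G * (R * X))))"
    using R G X by (simp add: RKRZ dist tr)
  have t3: "mtrace (R * (K * (R * (R * (R * X))))) = mtrace (G * (R * (R * (R * X)))) - mtrace (R * (G * (R * (R * X))))"
    using R G X by (simp add: RKRZ dist tr)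
  have l1: "mtrace (S * (G * X - X * G)) = mtrace (K * X)"
  proof -
    have "mtrace (S * (G * X - X * G)) = mtrace (S * (G * X)) - mtrace ((S * X) * G)"
      using cS G X by (simp add: dist tr a)
    also have "mtrace ((S * X) * G) = mtrace (G * (S * X))"
      by (rule mtrace_comm[of _ d d]) (use cS G X in auto)
    also have "mtrace (S * (G * X)) - mtrace (G * (S * X)) = mtrace (K * X)"
      unfolding K_def using cS G X by (simp add: dist tr a)
    finally show ?thesis .
  qed
  have l2: "mtrace (R * (R * (G * X - X * G) * R)) = mtrace (R * (R * (R * (G * X)))) - mtrace (G * (R * (R * (R * X))))"
  proof -
    have "mtrace (R * (R * (G * X - X * G) * R)) = mtrace ((R * (R * (G * X))) * R) - mtrace ((R * (R * X)) * (G * R))"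
      using R G X by (simp add: dist tr a)
    also have "mtrace ((R * (R * (G * X))) * R) = mtrace (R * (R * (R * (G * X))))"
      by (rule mtrace_comm[of _ d d]) (use R G X in auto)
    also have "mtrace ((R * (R * X)) * (G * R)) = mtrace ((G * R) * (R * (R * X)))"
      by (rule mtrace_comm[of _ d d]) (use R G X in auto)
    also have "(G * R) * (R * (R * X)) = G * (R * (R * (R * X)))"
      using R G X by (simp add: a)
    finally show ?thesis .
  qed
  have gRR: "gram d (R * R)" using gram_adjoint_mult_self[OF R] gram_adjoint[OF gR] by simp
  have gRRR: "gram d (R * R * R)" using gram_conj[OF gR R] gram_adjoint[OF gR] by simp
  \<comment> \<open>By cyclicity the trace is that of \<open>K\<^sup>* A K\<close> times
    \<open>B\<close>, a product of two positive semidefinite matrices.\<close>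
  have pos: "0 \<le> Re (mtrace (A * (K * (B * X))))" if "gram d A" "gram d B" for A B
  proof -
    note c = gram_carrier[OF that(1)] gram_carrier[OF that(2)]
    have "mtrace (A * (K * (B * X))) = mtrace ((A * K * B) * X)"
      using c K X by (simp add: a)
    also have "\<dots> = mtrace (X * (A * K * B))"
      by (rule mtrace_comm[of _ d d]) (use c K X in auto)
    also have "X * (A * K * B) = (mat_adjoint K * A * K) * B"
      using c K unfolding X_def by (simp add: a mult_carrier_mat[of _ d d _ d])
    finally show ?thesis using mtrace_gram_mult_nonneg[OF gram_conj[OF that(1) K] that(2)] by simp
  qed
  have p1: "0 \<le> Re (mtrace (R * (R * (R * (K * (R * X))))))"
    using pos[OF gRRR gR] R K X by (simp add: a)
  have p2: "0 \<le> Re (mtrace (R * (R * (K * (R * (R * X))))))"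
    using pos[OF gRR gRR] R K X by (simp add: a)
  have p3: "0 \<le> Re (mtrace (R * (K * (R * (R * (R * X))))))"
    using pos[OF gR gRRR] R K X by (simp add: a)
  have "mtrace (K * X) = mtrace (X * K)" by (rule mtrace_comm[OF K X])
  also have "\<dots> = complex_of_real (frob_sq K)" unfolding X_def by (rule mtrace_adjoint_mult_self)
  finally have "Re (mtrace (K * X)) = frob_sq K" by simp
  moreover have "Re (mtrace (K * X)) \<le> 0"
    using crit p1 p2 p3 unfolding l1 l2 t1 t2 t3 by simp
  ultimately have "frob_sq K = 0" using frob_sq_nonneg[of K] by simp
  then have K0: "K = 0\<^sub>m d d" using frob_sq_eq_0[OF K] by simp
  have cSG: "S * G \<in> carrier_mat d d" "G * S \<in> carrier_mat d d" using cS G by auto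
  show ?thesis
  proof (rule eq_matI)
    fix i j assume ij: "i < dim_row (G * S)" "j < dim_col (G * S)"
    then have "K $$ (i, j) = (S * G) $$ (i, j) - (G * S) $$ (i, j)"
      unfolding K_def by (rule index_minus_mat(1))
    moreover have "i < d" "j < d" using ij cSG by auto
    ultimately show "(S * G) $$ (i, j) = (G * S) $$ (i, j)" unfolding K0 by simp
  qed (use cS G in auto)
qed

section \<open>Feasible pairs and the canonical dual\<close>

text \<open>Invertibility of the two frame operators is derived from duality, used once in each
  order.\<close>

lemma DRS_I:
  assumes V: "is_system m k d V" and W: "is_system m k d W" and dual: "cross_op m d W V = 1\<^sub>m d"
    and norm: "\<And>i. i < m \<Longrightarrow> V i * mat_adjoint (V i) = complex_of_real ((v i)\<^sup>2) \<cdot>\<^sub>m 1\<^sub>m (k i)"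
  shows "(V, W) \<in> DRS v m k d"
proof -
  have "cross_op m d V W = 1\<^sub>m d"
    using mat_adjoint_cross_op[OF W V] dual by simp
  then have "V \<in> Pv v m k d"
    using V norm invertible_rs_op_of_dual[OF W V] unfolding Pv_def RS_def by simp
  moreover have "W \<in> RS m k d"
    using W invertible_rs_op_of_dual[OF V W dual] unfolding RS_def by simp
  ultimately show ?thesis using dual unfolding DRS_def duals_def by simp
qed

lemma DRS_D:
  assumes "(V, W) \<in> DRS v m k d"
  shows "is_system m k d V" "is_system m k d W" "cross_op m d W V = 1\<^sub>m d"
    "i < m \<Longrightarrow> V i * mat_adjoint (V i) = complex_of_real ((v i)\<^sup>2) \<cdot>\<^sub>m 1\<^sub>m (k i)"
    "det (rs_op m d V) \<noteq> 0"
proof -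
  show V: "is_system m k d V" and "is_system m k d W" "cross_op m d W V = 1\<^sub>m d"
    using assms by (auto simp: DRS_def Pv_def RS_def duals_def)
  show "i < m \<Longrightarrow> V i * mat_adjoint (V i) = complex_of_real ((v i)\<^sup>2) \<cdot>\<^sub>m 1\<^sub>m (k i)"
    using assms by (auto simp: DRS_def Pv_def)
  show "det (rs_op m d V) \<noteq> 0"
    using assms invertible_mat_iff_det[OF cross_op_carrier[OF V V]]
    by (auto simp: DRS_def Pv_def RS_def rs_op_eq_cross_op)
qed

text \<open>\<open>R S = 1\<close> is duality, and \<open>R S R = R\<close> shows that the dual has
  frame operator \<open>S\<inverse>\<close>. On canonical pairs the joint potential is therefore
  \<open>tr S\<^sup>2 + tr S\<^sup>-\<^sup>2\<close>.\<close>

lemma canonical_dual: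
  assumes V: "is_system m k d V" and R: "R \<in> carrier_mat d d" and SR: "rs_op m d V * R = 1\<^sub>m d"
  shows "cross_op m d (\<lambda>i. V i * R) V = 1\<^sub>m d" "rs_op m d (\<lambda>i. V i * R) = R"
proof -
  have adj: "mat_adjoint R = R"
    using gram_adjoint[OF gram_inverse[OF gram_rs_op[OF V] R SR]] .
  have S: "cross_op m d V V * R = 1\<^sub>m d" using SR by (simp add: rs_op_eq_cross_op)
  note cS = cross_op_carrier[OF V V]
  have RS: "R * cross_op m d V V = 1\<^sub>m d" by (rule mat_mult_left_right_inverse[OF cS R S])
  show "cross_op m d (\<lambda>i. V i * R) V = 1\<^sub>m d"
    unfolding cross_op_mult_left[OF V V R] adj by (rule RS)
  show "rs_op m d (\<lambda>i. V i * R) = R"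
    unfolding rs_op_eq_cross_op cross_op_conj[OF V R] adj RS using R by simp
qed

text \<open>Among the duals \<open>V\<^sub>iR + c Z\<^sub>i\<close>, \<open>Z = W - VR\<close>, the frame operator is \<open>R + c\<^sup>2S\<^sub>Z\<close> because the
  cross terms vanish; so shrinking \<open>c\<close> from 1 strictly decreases the potential unless \<open>Z = 0\<close>.\<close>

lemma local_minimizer_canonical:
  assumes min: "local_dP_minimizer v m k d V W"
    and R: "R \<in> carrier_mat d d" and SR: "rs_op m d V * R = 1\<^sub>m d" and i: "i < m"
  shows "W i = V i * R"
proof -
  from min obtain e where VW: "(V, W) \<in> DRS v m k d" and e: "e > 0"
    and le: "\<And>V' W'. (V', W') \<in> DRS v m k d \<Longrightarrow> dP m V V' + dP m W W' < e \<Longrightarrow> FP m d V W \<le> FP m d V' W'"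
    unfolding local_dP_minimizer_def by blast
  note V = DRS_D(1)[OF VW] and W = DRS_D(2)[OF VW] and dual = DRS_D(3)[OF VW]
  note norm = DRS_D(4)[OF VW]
  note gR = gram_inverse[OF gram_rs_op[OF V] R SR]
  note VR = is_system_mult[OF V R]
  define Z where "Z i = W i - V i * R" for i
  have Z: "is_system m k d Z" unfolding Z_def by (rule is_system_minus[OF W VR])
  \<comment> \<open>\<open>W\<close> and the canonical dual have the same cross operator with
    \<open>V\<close>, so their difference \<open>Z\<close> has cross operator 0.\<close>
  have VZ: "cross_op m d V Z = 0\<^sub>m d d"
  proof -
    have "cross_op m d V W = 1\<^sub>m d" using mat_adjoint_cross_op[OF W V] dual by simp
    then show ?thesis
      unfolding Z_def using cross_op_minus_right[OF V W VR] cross_op_mult_right[OF V V R] SR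
      by (simp add: rs_op_eq_cross_op minus_r_inv_mat[OF one_carrier_mat])
  qed
  have ZV: "cross_op m d Z V = 0\<^sub>m d d" using mat_adjoint_cross_op[OF V Z] VZ by simp
  have VRZ: "cross_op m d (\<lambda>i. V i * R) Z = 0\<^sub>m d d" and ZVR: "cross_op m d Z (\<lambda>i. V i * R) = 0\<^sub>m d d"
    using R unfolding cross_op_mult_left[OF V Z R] cross_op_mult_right[OF Z V R] VZ ZV by auto
  define Q where "Q = rs_op m d Z"
  have gQ: "gram d Q" unfolding Q_def by (rule gram_rs_op[OF Z])
  note cQ = gram_carrier[OF gQ]
  \<comment> \<open>\<open>Wc 0\<close> is the canonical dual, \<open>Wc 1\<close> agrees with
    \<open>W\<close> below \<open>m\<close>, and every \<open>Wc c\<close> is a dual of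
    \<open>V\<close>.\<close>
  define Wc where "Wc c i = V i * R + complex_of_real c \<cdot>\<^sub>m Z i" for c i
  have sysc: "is_system m k d (Wc c)" for c
    unfolding Wc_def by (rule is_system_add[OF VR is_system_smult[OF Z]])
  have W1: "Wc 1 i = W i" if "i < m" for i
  proof -
    have "A + complex_of_real 1 \<cdot>\<^sub>m (B - A) = B" if "A \<in> carrier_mat (k i) d" "B \<in> carrier_mat (k i) d" for A B
      by (rule eq_matI) (use that in auto)
    then show ?thesis using that VR W unfolding Wc_def Z_def is_system_def by blast
  qed
  have adjZ: "cross_op m d (Wc c) U = mat_adjoint (cross_op m d U (Wc c))" if "is_system m k d U" for U c
    by (rule mat_adjoint_cross_op[OF that sysc, symmetric])
  have right: "cross_op m d U (Wc c) = cross_op m d U (\<lambda>i. V i * R) + complex_of_real c \<cdot>\<^sub>m cross_op m d U Z"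
    if U: "is_system m k d U" for U c
    unfolding Wc_def using cross_op_add_right[OF U VR is_system_smult[OF Z]] cross_op_smult_right[OF U Z] by simp
  have dualc: "cross_op m d (Wc c) V = 1\<^sub>m d" for c
    unfolding adjZ[OF V] right[OF V] VZ cross_op_mult_right[OF V V R]
    using SR by (simp add: rs_op_eq_cross_op)
  have opc: "rs_op m d (Wc c) = R + complex_of_real (c\<^sup>2) \<cdot>\<^sub>m Q" for c
  proof -
    have "cross_op m d (Wc c) (\<lambda>i. V i * R) = R"
      unfolding adjZ[OF VR] right[OF VR] VRZ using canonical_dual(2)[OF V R SR] R gram_adjoint[OF gR]
      by (simp add: rs_op_eq_cross_op)
    moreover have "cross_op m d (Wc c) Z = complex_of_real c \<cdot>\<^sub>m Q"
      unfolding adjZ[OF Z] right[OF Z] ZVR using cQ gram_adjoint[OF gQ]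
      by (simp add: Q_def rs_op_eq_cross_op mat_adjoint_smult)
    ultimately show ?thesis
      unfolding rs_op_eq_cross_op right[OF sysc] using cQ R by (auto intro!: eq_matI simp: power2_eq_square)
  qed
  define b where "b = Re (mtrace (R * Q))"
  have b: "0 \<le> b" unfolding b_def by (rule mtrace_gram_mult_nonneg[OF gR gQ])
  have trQQ: "mtrace (Q * Q) = complex_of_real (frob_sq Q)"
    using mtrace_adjoint_mult_self[of Q] gram_adjoint[OF gQ] by simp
  \<comment> \<open>Besides the constant, only the second and fourth powers of \<open>c\<close>
    occur; their coefficients \<open>2 b\<close> and \<open>tr Q\<^sup>2\<close> are
    nonnegative.\<close>
  have pot: "FP m d V (Wc c) = FP m d V (Wc 0) + 2 * c\<^sup>2 * b + (c\<^sup>2)\<^sup>2 * frob_sq Q" for c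
  proof -
    have exp: "mtrace ((R + x \<cdot>\<^sub>m Q) * (R + x \<cdot>\<^sub>m Q)) = mtrace (R * R) + 2 * x * mtrace (R * Q) + x\<^sup>2 * mtrace (Q * Q)" for x
    proof -
      have "(R + x \<cdot>\<^sub>m Q) * (R + x \<cdot>\<^sub>m Q) = R * R + x \<cdot>\<^sub>m (Q * R) + x \<cdot>\<^sub>m (R * Q + x \<cdot>\<^sub>m (Q * Q))"
        using R cQ by (simp add: add_mult_distrib_mat[of _ d d _ _ d] mult_add_distrib_mat[of _ d d _ d]
            mult_smult_distrib[of _ d d _ d] mult_smult_assoc_mat[of _ d d _ d])
      then show ?thesis
        using R cQ mtrace_comm[OF R cQ]
        by (simp add: mtrace_add[of _ d] mtrace_smult[of _ d] power2_eq_square distrib_left)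
    qed
    show ?thesis unfolding FP_def opc exp by (simp add: b_def trQQ power2_eq_square)
  qed
  have "((\<lambda>t. dP m W (Wc (1 - t))) \<longlongrightarrow> 0) (nhds 0)"
  proof (rule dP_tendsto_0[OF W sysc])
    fix i a b assume ib: "i < m" "a < k i" "b < d"
    then have "Wc (1 - t) i $$ (a, b) = (V i * R) $$ (a, b) + complex_of_real (1 - t) * Z i $$ (a, b)" for t
      using Z VR unfolding Wc_def is_system_def by (auto simp del: index_mult_mat(1))
    moreover have "((\<lambda>t. (V i * R) $$ (a, b) + complex_of_real (1 - t) * Z i $$ (a, b)) \<longlongrightarrow>
        (V i * R) $$ (a, b) + complex_of_real (1 - 0) * Z i $$ (a, b)) (nhds 0)"
      by (intro tendsto_intros filterlim_ident)
    moreover have "(V i * R) $$ (a, b) + complex_of_real (1 - 0) * Z i $$ (a, b) = W i $$ (a, b)"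
      using calculation(1)[of 0] W1[OF ib(1)] by simp
    ultimately show "((\<lambda>t. Wc (1 - t) i $$ (a, b)) \<longlongrightarrow> W i $$ (a, b)) (nhds 0)" by simp
  qed
  then have "\<forall>\<^sub>F t in nhds 0. dP m W (Wc (1 - t)) < e"
    using e by (rule order_tendstoD(2))
  then obtain \<delta> where \<delta>: "\<delta> > 0" "\<And>t. dist t 0 < \<delta> \<Longrightarrow> dP m W (Wc (1 - t)) < e"
    unfolding eventually_nhds_metric by blast
  \<comment> \<open>Small enough to stay in the neighbourhood of the minimizer, and at most 1/2 so
    that \<open>0 < 1 - t < 1\<close>.\<close>
  define t where "t = min (1/2) (\<delta>/2)"
  have t: "0 < t" "t < 1" "dist t 0 < \<delta>" using \<delta>(1) by (auto simp: t_def)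
  have "dP m V V = 0" unfolding dP_def frob_sq_def by (auto intro!: sum.neutral)
  then have "FP m d V W \<le> FP m d V (Wc (1 - t))"
    using \<delta>(2)[OF t(3)] by (intro le DRS_I[OF V sysc dualc] norm) auto
  moreover have "FP m d V W = FP m d V (Wc 1)"
    unfolding FP_def rs_op_eq_cross_op using cross_op_cong[of m "Wc 1" W "Wc 1" W d] W1 by simp
  ultimately have ineq: "2 * b + frob_sq Q \<le> 2 * (1 - t)\<^sup>2 * b + ((1 - t)\<^sup>2)\<^sup>2 * frob_sq Q"
    using pot[of 1] pot[of "1 - t"] by simp
  have c1: "(1 - t)\<^sup>2 < 1" "0 \<le> (1 - t)\<^sup>2" using t by (auto simp: power_less_one_iff)
  have c2: "((1 - t)\<^sup>2)\<^sup>2 < 1" using power_less_one_iff[OF c1(2), of 2] c1(1) by (simp del: power_mult)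
  \<comment> \<open>The \<open>b\<close> term does not grow when \<open>c\<close> shrinks from 1 to
    \<open>1 - t\<close>, so it cancels from \<open>ineq\<close>; the remaining factor is below 1
    and forces \<open>Q = 0\<close>.\<close>
  have "(1 - t)\<^sup>2 * b \<le> b" using c1 b by (intro mult_left_le_one_le) auto
  then have "frob_sq Q \<le> ((1 - t)\<^sup>2)\<^sup>2 * frob_sq Q" using ineq by linarith
  moreover have "((1 - t)\<^sup>2)\<^sup>2 * frob_sq Q < 1 * frob_sq Q" if "frob_sq Q > 0"
    using c2 that by (rule mult_strict_right_mono)
  ultimately have "frob_sq Q = 0" using frob_sq_nonneg[of Q] by linarith
  then have "Q = 0\<^sub>m d d" by (rule frob_sq_eq_0[OF cQ])
  then have "(\<Sum>i<m. frob_sq (Z i)) = 0"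
    using mtrace_cross_op_self[OF Z] unfolding Q_def rs_op_eq_cross_op
    by (simp add: mtrace_def flip: of_real_sum)
  then have "frob_sq (Z i) = 0"
    using i by (subst (asm) sum_nonneg_eq_0_iff) (auto simp: frob_sq_nonneg)
  then have "Z i = 0\<^sub>m (k i) d" using Z i frob_sq_eq_0 unfolding is_system_def by blast
  moreover have "V i * R \<in> carrier_mat (k i) d" using VR i unfolding is_system_def by simp
  ultimately show ?thesis
    using W1[OF i] unfolding Wc_def by (auto simp: right_add_zero_mat)
qed

section \<open>First variation under rotation of one operator\<close>

text \<open>The pair is moved along a curve: \<open>V i\<close> is multiplied on the right by
  unitaries, which preserves \<open>V\<^sub>i V\<^sub>i\<^sup>*\<close>, and the second component is
  kept canonical. At 0 the curve meets the minimizer by \<open>local_minimizer_canonical\<close>, so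
  the derivative of the potential vanishes there.\<close>

lemma local_minimizer_commutes:
  assumes min: "local_dP_minimizer v m k d V W" and i: "i < m"
  shows "rs_op m d V * (mat_adjoint (V i) * V i) = mat_adjoint (V i) * V i * rs_op m d V"
proof -
  from min obtain e where VW: "(V, W) \<in> DRS v m k d" and e: "e > 0"
    and le: "\<And>V' W'. (V', W') \<in> DRS v m k d \<Longrightarrow> dP m V V' + dP m W W' < e \<Longrightarrow> FP m d V W \<le> FP m d V' W'"
    unfolding local_dP_minimizer_def by blast
  note V = DRS_D(1)[OF VW] and W = DRS_D(2)[OF VW] and norm = DRS_D(4)[OF VW]
  define S where "S = rs_op m d V"
  define R where "R = minv S"
  define G where "G = mat_adjoint (V i) * V i"
  have gS: "gram d S" unfolding S_def by (rule gram_rs_op[OF V])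
  note cS = gram_carrier[OF gS]
  have detS: "det S \<noteq> 0" unfolding S_def by (rule DRS_D(5)[OF VW])
  have cR: "R \<in> carrier_mat d d" unfolding R_def by (rule minv_carrier[OF cS])
  have SR: "S * R = 1\<^sub>m d" and RS: "R * S = 1\<^sub>m d" unfolding R_def using minv[OF cS detS] by auto
  have WR: "W j = V j * R" if "j < m" for j
    using local_minimizer_canonical[OF min cR SR[unfolded S_def] that] .
  have Vi: "V i \<in> carrier_mat (k i) d" using V i by (simp add: is_system_def)
  have cG: "G \<in> carrier_mat d d" unfolding G_def by (rule adjoint_mult_carrier[OF Vi Vi])
  have adjG: "mat_adjoint G = G" unfolding G_def by (rule gram_adjoint[OF gram_adjoint_mult_self[OF Vi]])
  \<comment> \<open>\<open>S\<close> and \<open>G\<close> are self-adjoint, so their commutator is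
    skew-adjoint and \<open>X = - K\<close> is an infinitesimal rotation. With this choice the first
    variation pairs \<open>K\<close> with its own adjoint.\<close>
  define K where "K = S * G - G * S"
  define X where "X = mat_adjoint K"
  have cSG: "S * G \<in> carrier_mat d d" and cGS: "G * S \<in> carrier_mat d d" using cS cG by auto
  have cK: "K \<in> carrier_mat d d" unfolding K_def using cGS by (rule minus_carrier_mat)
  have cX: "X \<in> carrier_mat d d" unfolding X_def using cK by simp
  have XK: "X = G * S - S * G"
    unfolding X_def K_def mat_adjoint_minus[OF cSG cGS] mat_adjoint_mult[OF cS cG] mat_adjoint_mult[OF cG cS]
      adjG gram_adjoint[OF gS] ..
  have skew: "mat_adjoint X = - X"
  proof -
    have "mat_adjoint X = K" unfolding X_def by simp
    also have "\<dots> = - X" unfolding XK K_def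
      by (rule eq_matI) (use cSG cGS in \<open>auto simp del: index_mult_mat\<close>)
    finally show ?thesis .
  qed
  obtain U where U: "has_mat_deriv d d U X" and U0: "U 0 = 1\<^sub>m d"
    and unit: "\<forall>\<^sub>F t in nhds 0. U t * mat_adjoint (U t) = 1\<^sub>m d"
    using unitary_path[OF cX skew] .
  define Y where "Y t = V i * U t" for t
  have Y0: "Y 0 = V i" unfolding Y_def U0 using Vi by simp
  have Y: "has_mat_deriv (k i) d Y (V i * X)"
  proof -
    have "V i * X + 0\<^sub>m (k i) d * U 0 = V i * X"
      using Vi cX U0 by simp
    then show ?thesis
      using has_mat_deriv_mult[OF has_mat_deriv_const[OF Vi] U] unfolding Y_def by simp
  qed
  note cY = has_mat_derivD(1)[OF Y]
  define V' where "V' t = V(i := Y t)" for t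
  have V': "is_system m k d (V' t)" for t
    using V cY unfolding V'_def is_system_def by auto
  have V'0: "V' 0 = V" unfolding V'_def Y0 by simp
  define S' where "S' t = rs_op m d (V' t)" for t
  define R' where "R' t = minv (S' t)" for t
  define A where "A = G * X - X * G"
  have S'0: "S' 0 = S" unfolding S'_def S_def V'0 ..
  have R'0: "R' 0 = R" unfolding R'_def R_def S'0 ..
  \<comment> \<open>Only the summand of index \<open>i\<close> moves. The product rule gives
    \<open>G X + X\<^sup>* G\<close>, and skewness of \<open>X\<close> turns this into the
    commutator \<open>A\<close>.\<close>
  have S': "has_mat_deriv d d S' A"
  proof -
    have S'_eq: "S' = (\<lambda>t. S + (mat_adjoint (Y t) * Y t - G))"
      unfolding S'_def S_def G_def V'_def rs_op_eq_cross_op cross_op_update[OF V i cY] ..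
    have "has_mat_deriv d d S' (0\<^sub>m d d +
        (mat_adjoint (Y 0) * (V i * X) + mat_adjoint (V i * X) * Y 0 - 0\<^sub>m d d))"
      unfolding S'_eq by (intro has_mat_deriv_add has_mat_deriv_minus has_mat_deriv_mult[OF has_mat_deriv_adjoint[OF Y] Y]
        has_mat_deriv_const cS cG)
    moreover have "mat_adjoint (Y 0) * (V i * X) = G * X"
      unfolding Y0 G_def using assoc_mult_mat[OF mat_adjoint_carrier[OF Vi] Vi cX] by simp
    moreover have "mat_adjoint (V i * X) * Y 0 = - (X * G)"
    proof -
      have "mat_adjoint (V i * X) * Y 0 = (- X) * G"
        unfolding Y0 G_def mat_adjoint_mult[OF Vi cX] skew
        using assoc_mult_mat[OF uminus_carrier_mat[OF cX] mat_adjoint_carrier[OF Vi] Vi] .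
      also have "\<dots> = - (X * G)" using cX cG by simp
      finally show ?thesis .
    qed
    moreover have "0\<^sub>m d d + (G * X + - (X * G) - 0\<^sub>m d d) = A"
      unfolding A_def using mult_carrier_mat[OF cG cX] mult_carrier_mat[OF cX cG]
      by (intro eq_matI) (auto simp del: index_mult_mat)
    ultimately show ?thesis by simp
  qed
  note cS' = has_mat_derivD(1)[OF S'] and cA = has_mat_derivD(2)[OF S']
  have "det (S' 0) \<noteq> 0" unfolding S'0 by (rule detS)
  note R' = has_mat_deriv_minv[OF S' this, folded R'_def, unfolded R'0]
  note cR' = has_mat_derivD(1)[OF R']
  have ev_det: "\<forall>\<^sub>F t in nhds 0. det (S' t) \<noteq> 0"
    by (rule eventually_det_neq_0[OF S' \<open>det (S' 0) \<noteq> 0\<close>])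
  define W' where "W' t j = V' t j * R' t" for t j
  have W': "is_system m k d (W' t)" for t
    unfolding W'_def by (rule is_system_mult[OF V' cR'])
  have V'_deriv: "\<exists>D. has_mat_deriv (k j) d (\<lambda>t. V' t j) D" if "j < m" for j
  proof (cases "j = i")
    case True
    then show ?thesis using Y unfolding V'_def by auto
  next
    case False
    then show ?thesis using has_mat_deriv_const[of "V j" "k j" d] V that
      unfolding V'_def is_system_def by auto
  qed
  have "((\<lambda>t. dP m V (V' t)) \<longlongrightarrow> 0) (nhds 0)"
  proof (rule dP_tendsto_0[OF V V'])
    fix j a b assume j: "j < m" "a < k j" "b < d"
    from V'_deriv[OF j(1)] obtain D where "has_mat_deriv (k j) d (\<lambda>t. V' t j) D" ..
    from has_mat_deriv_tendsto[OF this j(2,3)]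
    show "((\<lambda>t. V' t j $$ (a, b)) \<longlongrightarrow> V j $$ (a, b)) (nhds 0)" unfolding V'0 .
  qed
  \<comment> \<open>At 0 the second component is \<open>V j * R\<close>, which is \<open>W j\<close>
    because the dual of a minimizer is canonical.\<close>
  moreover have "((\<lambda>t. dP m W (W' t)) \<longlongrightarrow> 0) (nhds 0)"
  proof (rule dP_tendsto_0[OF W W'])
    fix j a b assume j: "j < m" "a < k j" "b < d"
    from V'_deriv[OF j(1)] obtain D where "has_mat_deriv (k j) d (\<lambda>t. V' t j) D" ..
    from has_mat_deriv_tendsto[OF has_mat_deriv_mult[OF this R'] j(2,3)]
    show "((\<lambda>t. W' t j $$ (a, b)) \<longlongrightarrow> W j $$ (a, b)) (nhds 0)"
      unfolding W'_def V'0 R'0 WR[OF j(1)] .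
  qed
  ultimately have "((\<lambda>t. dP m V (V' t) + dP m W (W' t)) \<longlongrightarrow> 0 + 0) (nhds 0)"
    by (rule tendsto_add)
  then have "\<forall>\<^sub>F t in nhds 0. dP m V (V' t) + dP m W (W' t) < e"
    using e by (intro order_tendstoD(2)) auto
  then have "\<forall>\<^sub>F t in nhds 0. FP m d (V' 0) (W' 0) \<le> FP m d (V' t) (W' t)"
    using ev_det unit
  proof eventually_elim
    case (elim t)
    have "(V' t, W' t) \<in> DRS v m k d"
    proof (rule DRS_I[OF V' W'])
      show "cross_op m d (W' t) (V' t) = 1\<^sub>m d"
        unfolding W'_def using canonical_dual(1)[OF V' cR'] minv(1)[OF cS' elim(2)]
        by (simp add: R'_def S'_def)
      fix j assume j: "j < m"
      show "V' t j * mat_adjoint (V' t j) = complex_of_real ((v j)\<^sup>2) \<cdot>\<^sub>m 1\<^sub>m (k j)"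
      proof (cases "j = i")
        case True
        note cU = has_mat_derivD(1)[OF U, of t]
        have "Y t * mat_adjoint (Y t) = V i * (U t * (mat_adjoint (U t) * mat_adjoint (V i)))"
          unfolding Y_def mat_adjoint_mult[OF Vi cU]
          by (rule assoc_mult_mat[OF Vi cU mult_carrier_mat[OF mat_adjoint_carrier[OF cU] mat_adjoint_carrier[OF Vi]]])
        also have "U t * (mat_adjoint (U t) * mat_adjoint (V i)) = mat_adjoint (V i)"
          using assoc_mult_mat[OF cU mat_adjoint_carrier[OF cU] mat_adjoint_carrier[OF Vi]]
            left_mult_one_mat[OF mat_adjoint_carrier[OF Vi]] elim(3) by simp
        finally show ?thesis using norm[OF i] True by (simp add: V'_def)
      next
        case False
        then show ?thesis using norm[OF j] by (simp add: V'_def)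
      qed
    qed
    \<comment> \<open>\<open>W' 0\<close> and \<open>W\<close> agree at the indices below
      \<open>m\<close>, and the potential sees no others.\<close>
    from le[OF this elim(1)] show ?case
      unfolding V'0 FP_def rs_op_eq_cross_op
      using cross_op_cong[of m W "W' 0" W "W' 0" d] WR V'0 R'0 unfolding W'_def by simp
  qed
  moreover have "\<forall>\<^sub>F t in nhds 0. FP m d (V' t) (W' t) = Re (mtrace (S' t * S' t) + mtrace (R' t * R' t))"
    using ev_det
  proof eventually_elim
    case (elim t)
    have "rs_op m d (W' t) = R' t"
      unfolding W'_def using canonical_dual(2)[OF V' cR'] minv(1)[OF cS' elim]
      by (simp add: R'_def S'_def)
    then show ?case unfolding FP_def S'_def by simp
  qed
  ultimately have "\<forall>\<^sub>F t in nhds 0. Re (mtrace (S * S) + mtrace (R * R))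
      \<le> Re (mtrace (S' t * S' t) + mtrace (R' t * R' t))"
    using eventually_nhds_x_imp_x[of _ "0::real"] unfolding S'0[symmetric] R'0[symmetric]
    by (smt (verit, best) eventually_elim2)
  then obtain \<delta> where \<delta>: "\<delta> > 0" "\<And>t. dist t 0 < \<delta> \<Longrightarrow> Re (mtrace (S * S) + mtrace (R * R))
      \<le> Re (mtrace (S' t * S' t) + mtrace (R' t * R' t))"
    unfolding eventually_nhds_metric by blast
  \<comment> \<open>Product rule for both squares, with \<open>- (R * A * R)\<close> as the
    derivative of the inverse.\<close>
  let ?D = "mtrace (S * A + A * S) + mtrace (R * - (R * A * R) + - (R * A * R) * R)"
  have "((\<lambda>t. mtrace (S' t * S' t) + mtrace (R' t * R' t)) has_vector_derivative ?D) (at 0)"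
    using has_vector_derivative_add[OF has_mat_deriv_mtrace[OF has_mat_deriv_mult[OF S' S']]
        has_mat_deriv_mtrace[OF has_mat_deriv_mult[OF R' R']]] unfolding S'0 R'0 .
  from bounded_linear.has_vector_derivative[OF bounded_linear_Re this]
  have "((\<lambda>t. Re (mtrace (S' t * S' t) + mtrace (R' t * R' t))) has_real_derivative Re ?D) (at 0)"
    by (simp only: has_real_derivative_iff_has_vector_derivative)
  from DERIV_local_min[OF this \<delta>(1)] have D0: "Re ?D = 0"
    using \<delta>(2) unfolding S'0 R'0 by (simp add: dist_real_def)
  define B where "B = R * A * R"
  have cB: "B \<in> carrier_mat d d" unfolding B_def using cR cA by auto
  \<comment> \<open>By cyclicity each square contributes twice one trace; dividing by 2 leaves
    exactly the criticality hypothesis of \<open>commutator_eq_0_of_critical\<close>.\<close>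
  have "mtrace (S * A + A * S) = 2 * mtrace (S * A)"
    using mtrace_add[OF mult_carrier_mat[OF cS cA] mult_carrier_mat[OF cA cS]] mtrace_comm[OF cS cA] by simp
  moreover have "mtrace (R * - B + - B * R) = - 2 * mtrace (R * B)"
  proof -
    have "R * - B + - B * R = (-1) \<cdot>\<^sub>m (R * B) + (-1) \<cdot>\<^sub>m (B * R)"
      using cR cB by (intro eq_matI) auto
    then show ?thesis
      using mtrace_comm[OF cR cB] mult_carrier_mat[OF cR cB] mult_carrier_mat[OF cB cR]
      by (simp add: mtrace_add[of _ d] mtrace_smult[of _ d])
  qed
  ultimately have "Re (mtrace (S * A)) = Re (mtrace (R * (R * A * R)))"
    using D0 unfolding B_def by simp
  then have "S * G = G * S"
    using commutator_eq_0_of_critical[OF gS cR SR RS cG] unfolding A_def X_def K_def by blast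
  then show ?thesis unfolding S_def G_def .
qed

section \<open>Eigenprojections\<close>

text \<open>\<open>G\<close> commutes with \<open>S - \<sigma>\<close> and so maps its kernel into
  itself, where \<open>P\<close> acts as the identity. Self-adjointness of \<open>P\<close> and
  \<open>G\<close> upgrades this invariance to commutation.\<close>

lemma spectral_proj_commutes:
  assumes proj: "spectral_proj d S \<sigma> P" and S: "S \<in> carrier_mat d d" and G: "G \<in> carrier_mat d d"
    and adjG: "mat_adjoint G = G" and comm: "S * G = G * S"
  shows "P * G = G * P"
proof -
  have P: "P \<in> carrier_mat d d" and PP: "P * P = P" and adjP: "mat_adjoint P = P"
    and range: "{P *\<^sub>v x | x. x \<in> carrier_vec d} = {x \<in> carrier_vec d. (S - \<sigma> \<cdot>\<^sub>m 1\<^sub>m d) *\<^sub>v x = 0\<^sub>v d}"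
    using proj unfolding spectral_proj_def is_orth_proj_onto_def by auto
  let ?T = "S - \<sigma> \<cdot>\<^sub>m 1\<^sub>m d"
  have T: "?T \<in> carrier_mat d d" by (rule minus_carrier_mat) simp
  have TG: "?T * G = G * ?T"
    using S G comm
    by (simp add: minus_mult_distrib_mat[of _ d d _ _ d] mult_minus_distrib_mat[of _ d d _ d]
        mult_smult_distrib[of _ d d _ d] mult_smult_assoc_mat[of _ d d _ d])
  have GP: "P * (G * P) = G * P"
  proof (rule eq_matI)
    fix a b assume "a < dim_row (G * P)" "b < dim_col (G * P)"
    then have ab: "a < d" "b < d" using G P by auto
    \<comment> \<open>\<open>y\<close> is column \<open>b\<close> of \<open>G * P\<close>. It lies
      in the kernel, hence in the range of \<open>P\<close>, and is fixed by
      \<open>P\<close>.\<close>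
    define y where "y = G *\<^sub>v (P *\<^sub>v unit_vec d b)"
    have e: "unit_vec d b \<in> carrier_vec d" by simp
    have Pe: "P *\<^sub>v unit_vec d b \<in> carrier_vec d" using mult_mat_vec_carrier[OF P e] .
    have "?T *\<^sub>v (P *\<^sub>v unit_vec d b) = 0\<^sub>v d" using range e by blast
    then have "?T *\<^sub>v y = G *\<^sub>v 0\<^sub>v d"
      unfolding y_def assoc_mult_mat_vec[OF T G Pe, symmetric] TG assoc_mult_mat_vec[OF G T Pe] by simp
    also have "\<dots> = 0\<^sub>v d" using G by (intro eq_vecI) auto
    finally have "y \<in> {P *\<^sub>v x | x. x \<in> carrier_vec d}"
      unfolding range y_def using mult_mat_vec_carrier[OF G Pe] by simp
    then obtain x where x: "x \<in> carrier_vec d" "y = P *\<^sub>v x" by blast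
    have "P *\<^sub>v y = y" unfolding x(2) assoc_mult_mat_vec[OF P P x(1), symmetric] PP ..
    moreover have "y = (G * P) *\<^sub>v unit_vec d b"
      unfolding y_def by (rule assoc_mult_mat_vec[OF G P e, symmetric])
    ultimately have "(P * (G * P)) *\<^sub>v unit_vec d b = (G * P) *\<^sub>v unit_vec d b"
      using assoc_mult_mat_vec[OF P mult_carrier_mat[OF G P] e] by simp
    moreover have "M *\<^sub>v unit_vec d b = col M b" if "M \<in> carrier_mat d d" for M :: "complex mat"
      using that ab by (intro eq_vecI) auto
    ultimately have "col (P * (G * P)) b = col (G * P) b"
      using mult_carrier_mat[OF G P] mult_carrier_mat[OF P mult_carrier_mat[OF G P]] by simp
    moreover have "M $$ (a, b) = col M b $ a" if "M \<in> carrier_mat d d" for M :: "complex mat"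
      using that ab by simp
    ultimately show "(P * (G * P)) $$ (a, b) = (G * P) $$ (a, b)"
      using mult_carrier_mat[OF G P] mult_carrier_mat[OF P mult_carrier_mat[OF G P]] by metis
  qed (use G P in auto)
  \<comment> \<open>The adjoint of \<open>P G P = G P\<close> is \<open>P G P = P G\<close>.\<close>
  have "P * G = P * (G * P)"
    using arg_cong[OF GP, of mat_adjoint] mat_adjoint_mult[OF P mult_carrier_mat[OF G P]]
      mat_adjoint_mult[OF G P] assoc_mult_mat[OF P G P] unfolding adjP adjG by simp
  then show ?thesis unfolding GP .
qed

theorem theorem6p6:
  fixes m d :: nat and k :: "nat \<Rightarrow> nat" and v :: "nat \<Rightarrow> real"
    and V W :: "nat \<Rightarrow> complex mat"
  assumes "m \<ge> 1" and "d \<ge> 1"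
    and "\<forall>i<m. 1 \<le> k i \<and> k i \<le> d"
    and "\<forall>i<m. v i > 0"
    and "local_dP_minimizer v m k d V W"
  shows "rs_op m d V \<in> commutant m d V \<and>
         (\<forall>\<sigma> P. eigenvalue (rs_op m d V) \<sigma> \<longrightarrow> spectral_proj d (rs_op m d V) \<sigma> P \<longrightarrow>
           P \<in> commutant m d V)"
proof -
  have V: "is_system m k d V"
    using assms(5) unfolding local_dP_minimizer_def by (blast intro: DRS_D(1))
  note S = gram_carrier[OF gram_rs_op[OF V]]
  note comm = local_minimizer_commutes[OF assms(5)]
  have "P \<in> commutant m d V" if P: "spectral_proj d (rs_op m d V) \<sigma> P" for \<sigma> P
  proof -
    have "P * (mat_adjoint (V i) * V i) = mat_adjoint (V i) * V i * P" if "i < m" for i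
    proof -
      have Vi: "V i \<in> carrier_mat (k i) d" using V that by (simp add: is_system_def)
      note g = gram_adjoint_mult_self[OF Vi]
      show ?thesis
        by (rule spectral_proj_commutes[OF P S gram_carrier[OF g] gram_adjoint[OF g] comm[OF that]])
    qed
    then show ?thesis
      using P unfolding commutant_def spectral_proj_def is_orth_proj_onto_def by auto
  qed
  moreover have "rs_op m d V \<in> commutant m d V"
    using S comm unfolding commutant_def by simp
  ultimately show ?thesis by blast
qed

end
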